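(* For every $n\ge 1$, the dimension of the $n$-th component of the nonsymmetric operad $\mathrm{noncom}\text{-}\mathrm{Flex}$ is $$\dim\big(\mathrm{noncom}\text{-}\mathrm{Flex}(n)\big)=\frac{1}{n}\binom{3n-2}{n-1}=\frac{(3n-2)!}{n!\,(2n-1)!}.$$
   Context: $\mathrm{noncom}\text{-}\mathrm{Flex}$ (the nonsymmetric flexible operad) is the nonsymmetric operad over a field $\Bbbk$ generated by two binary operations $\prec$ and $\succ$ subject to the single relation $$(x_1\succ x_2)\succ x_3-x_1\succ(x_2\succ x_3)-(x_1\prec x_2)\prec x_3+x_1\prec(x_2\prec x_3)=0.$$ (Its symmetrization is the white Manin product $\mathrm{As}\circ\mathrm{Flex}$ of the associative and flexible operads.) The component of arity $n$ is that of the nonsymmetric operad, i.e. the variables occur in the fixed order $x_1,\dots,x_n$. *)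

theory Defs
  imports Complex_Main "HOL-Library.Poly_Mapping" "HOL-Library.Tree"
begin

section \<open>Nonsymmetric operads and their ideals\<close>

(* P n is the component of arity n; all components are subspaces of one ambient vector space.
   comp f i g is the partial composition f o_i g, with inputs numbered from 1; nothing is required
   of comp outside the range 1 <= i <= m for f in P m. *)
locale ns_operad = vector_space scale
  for scale :: "'k::field \<Rightarrow> 'v::ab_group_add \<Rightarrow> 'v" +
  fixes P :: "nat \<Rightarrow> 'v set"
    and comp :: "'v \<Rightarrow> nat \<Rightarrow> 'v \<Rightarrow> 'v"
    and unit :: 'v
  assumes subspace_P: "subspace (P n)"
    and comp_closed: "\<lbrakk>f \<in> P m; g \<in> P n; 1 \<le> i; i \<le> m\<rbrakk> \<Longrightarrow> comp f i g \<in> P (m + n - 1)"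
    and comp_add_left: "\<lbrakk>f \<in> P m; f' \<in> P m; g \<in> P n; 1 \<le> i; i \<le> m\<rbrakk>
          \<Longrightarrow> comp (f + f') i g = comp f i g + comp f' i g"
    and comp_add_right: "\<lbrakk>f \<in> P m; g \<in> P n; g' \<in> P n; 1 \<le> i; i \<le> m\<rbrakk>
          \<Longrightarrow> comp f i (g + g') = comp f i g + comp f i g'"
    and comp_scale_left: "\<lbrakk>f \<in> P m; g \<in> P n; 1 \<le> i; i \<le> m\<rbrakk>
          \<Longrightarrow> comp (scale c f) i g = scale c (comp f i g)"
    and comp_scale_right: "\<lbrakk>f \<in> P m; g \<in> P n; 1 \<le> i; i \<le> m\<rbrakk>
          \<Longrightarrow> comp f i (scale c g) = scale c (comp f i g)"
    and unit_P: "unit \<in> P 1"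
    and comp_unit_left: "g \<in> P n \<Longrightarrow> comp unit 1 g = g"
    and comp_unit_right: "\<lbrakk>f \<in> P m; 1 \<le> i; i \<le> m\<rbrakk> \<Longrightarrow> comp f i unit = f"
    and comp_sequential: "\<lbrakk>f \<in> P l; g \<in> P m; h \<in> P n; 1 \<le> i; i \<le> l; 1 \<le> j; j \<le> m\<rbrakk>
          \<Longrightarrow> comp (comp f i g) (i - 1 + j) h = comp f i (comp g j h)"
    and comp_parallel: "\<lbrakk>f \<in> P l; g \<in> P m; h \<in> P n; 1 \<le> i; i < k; k \<le> l\<rbrakk>
          \<Longrightarrow> comp (comp f i g) (k - 1 + m) h = comp (comp f k h) i g"
begin

definition operad_ideal :: "(nat \<Rightarrow> 'v set) \<Rightarrow> bool" where
  "operad_ideal I \<longleftrightarrow>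
     (\<forall>n. subspace (I n) \<and> I n \<subseteq> P n) \<and>
     (\<forall>m n i. \<forall>f\<in>I m. \<forall>g\<in>P n. 1 \<le> i \<and> i \<le> m \<longrightarrow> comp f i g \<in> I (m + n - 1)) \<and>
     (\<forall>m n i. \<forall>f\<in>P m. \<forall>g\<in>I n. 1 \<le> i \<and> i \<le> m \<longrightarrow> comp f i g \<in> I (m + n - 1))"

definition generated_ideal :: "(nat \<Rightarrow> 'v set) \<Rightarrow> nat \<Rightarrow> 'v set" where
  "generated_ideal R n = \<Inter>{I n | I. operad_ideal I \<and> (\<forall>m. R m \<subseteq> I m)}"

lemma operad_ideal_P: "operad_ideal P"
  unfolding operad_ideal_def using subspace_P comp_closed by blast

lemma operad_ideal_generated_ideal:
  assumes "\<And>m. R m \<subseteq> P m"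
  shows "operad_ideal (generated_ideal R)"
proof -
  have gen: "f \<in> generated_ideal R n \<longleftrightarrow> (\<forall>I. operad_ideal I \<and> (\<forall>m. R m \<subseteq> I m) \<longrightarrow> f \<in> I n)"
    for f n
    by (auto simp: generated_ideal_def)
  have sub: "generated_ideal R n \<subseteq> P n" for n
    using operad_ideal_P assms by (auto simp: gen)
  moreover have "subspace (generated_ideal R n)" for n
    unfolding generated_ideal_def by (rule subspace_Inter) (auto simp: operad_ideal_def)
  moreover have "comp f i g \<in> generated_ideal R (m + n - 1)"
    if f: "f \<in> generated_ideal R m" and g: "g \<in> P n" and i: "1 \<le> i \<and> i \<le> m" for f g m n i
    unfolding gen
  proof (intro allI impI)
    fix I assume I: "operad_ideal I \<and> (\<forall>m. R m \<subseteq> I m)"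
    then have "f \<in> I m" using f unfolding gen by iprover
    with I g i show "comp f i g \<in> I (m + n - 1)" by (simp only: operad_ideal_def)
  qed
  moreover have "comp f i g \<in> generated_ideal R (m + n - 1)"
    if f: "f \<in> P m" and g: "g \<in> generated_ideal R n" and i: "1 \<le> i \<and> i \<le> m" for f g m n i
    unfolding gen
  proof (intro allI impI)
    fix I assume I: "operad_ideal I \<and> (\<forall>m. R m \<subseteq> I m)"
    then have "g \<in> I n" using g unfolding gen by iprover
    with I f i show "comp f i g \<in> I (m + n - 1)" by (simp only: operad_ideal_def)
  qed
  ultimately show ?thesis
    unfolding operad_ideal_def by blast
qed

end


section \<open>The free nonsymmetric operad on binary generators\<close>

(* The arity of a tree is its number of leaves, size1; graft t i s replaces the i-th leaf of t,
   counted from the left starting at 1, by s. *)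
fun graft :: "'g tree \<Rightarrow> nat \<Rightarrow> 'g tree \<Rightarrow> 'g tree" where
  "graft Leaf i s = s"
| "graft (Node l a r) i s =
     (if i \<le> size1 l then Node (graft l i s) a r else Node l a (graft r (i - size1 l) s))"

definition lincomb_scale :: "'k::field \<Rightarrow> ('a \<Rightarrow>\<^sub>0 'k) \<Rightarrow> ('a \<Rightarrow>\<^sub>0 'k)" where
  "lincomb_scale c f = Poly_Mapping.map ((*) c) f"

definition free_component :: "nat \<Rightarrow> ('g tree \<Rightarrow>\<^sub>0 'k::field) set" where
  "free_component n = {f. \<forall>t \<in> Poly_Mapping.keys f. size1 t = n}"

(* The bilinear extension of graft; a tree with fewer than i leaves contributes 0, so that
   composition is defined on the whole ambient space and still descends to quotients. *)
definition free_comp ::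
    "('g tree \<Rightarrow>\<^sub>0 'k::field) \<Rightarrow> nat \<Rightarrow> ('g tree \<Rightarrow>\<^sub>0 'k) \<Rightarrow> ('g tree \<Rightarrow>\<^sub>0 'k)" where
  "free_comp f i g = (\<Sum>t \<in> Poly_Mapping.keys f. \<Sum>s \<in> Poly_Mapping.keys g.
     if 1 \<le> i \<and> i \<le> size1 t
     then Poly_Mapping.single (graft t i s) (Poly_Mapping.lookup f t * Poly_Mapping.lookup g s)
     else 0)"

definition free_unit :: "'g tree \<Rightarrow>\<^sub>0 'k::field" where
  "free_unit = Poly_Mapping.single Leaf 1"

lemma size1_graft: "\<lbrakk>1 \<le> i; i \<le> size1 t\<rbrakk> \<Longrightarrow> size1 (graft t i s) = size1 t + size1 s - 1"
proof (induction t arbitrary: i)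
  case (Node l a r)
  have pos: "0 < size1 l" "0 < size1 r" "0 < size1 s" by simp_all
  show ?case
  proof (cases "i \<le> size1 l")
    case True
    then have "size1 (graft (Node l a r) i s) = size1 (graft l i s) + size1 r" by simp
    moreover have "size1 (graft l i s) = size1 l + size1 s - 1"
      using Node.IH(1) Node.prems(1) True by blast
    moreover have "size1 (Node l a r) = size1 l + size1 r" by simp
    ultimately show ?thesis using pos by linarith
  next
    case False
    then have "size1 (graft (Node l a r) i s) = size1 l + size1 (graft r (i - size1 l) s)" by simp
    moreover have "1 \<le> i - size1 l" "i - size1 l \<le> size1 r" using False Node.prems by simp_all
    then have "size1 (graft r (i - size1 l) s) = size1 r + size1 s - 1"
      by (rule Node.IH(2))
    moreover have "size1 (Node l a r) = size1 l + size1 r" by simp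
    ultimately show ?thesis using pos by linarith
  qed
qed simp

lemma graft_Leaf: "graft t i Leaf = t"
  by (induction t arbitrary: i) auto

lemma graft_sequential:
  "\<lbrakk>1 \<le> i; i \<le> size1 t; 1 \<le> j; j \<le> size1 s\<rbrakk>
    \<Longrightarrow> graft (graft t i s) (i - 1 + j) u = graft t i (graft s j u)"
proof (induction t arbitrary: i)
  case (Node l a r)
  have "0 < size1 l" "0 < size1 s" by simp_all
  show ?case
  proof (cases "i \<le> size1 l")
    case True
    then have "i - 1 + j \<le> size1 (graft l i s)"
      using Node.prems size1_graft[of i l s] by linarith
    then show ?thesis using True Node by simp
  next
    case False
    then have "i - 1 + j - size1 l = (i - size1 l) - 1 + j" "\<not> i - 1 + j \<le> size1 l"
      using Node.prems by linarith+
    then show ?thesis using False Node.IH(2)[of "i - size1 l"] Node.prems by auto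
  qed
qed simp

lemma graft_parallel:
  "\<lbrakk>1 \<le> i; i < k; k \<le> size1 t\<rbrakk>
    \<Longrightarrow> graft (graft t i s) (k - 1 + size1 s) u = graft (graft t k u) i s"
proof (induction t arbitrary: i k)
  case (Node l a r)
  have pos: "0 < size1 l" "0 < size1 s" "0 < size1 u" by simp_all
  consider "k \<le> size1 l" | "i \<le> size1 l" "\<not> k \<le> size1 l" | "\<not> i \<le> size1 l" by linarith
  then show ?case
  proof cases
    case 1
    then have "k - 1 + size1 s \<le> size1 (graft l i s)" "i \<le> size1 (graft l k u)"
      using Node.prems size1_graft[of i l s] size1_graft[of k l u] pos by linarith+
    then show ?thesis using 1 Node.IH(1)[of i k] Node.prems by simp
  next
    case 2
    then have "\<not> k - 1 + size1 s \<le> size1 (graft l i s)"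
      "k - 1 + size1 s - size1 (graft l i s) = k - size1 l"
      using Node.prems size1_graft[of i l s] pos by linarith+
    then show ?thesis using 2 by simp
  next
    case 3
    then have "\<not> k - 1 + size1 s \<le> size1 l" "\<not> k \<le> size1 l"
      "k - 1 + size1 s - size1 l = (k - size1 l) - 1 + size1 s"
      using Node.prems pos by linarith+
    then show ?thesis using 3 Node.IH(2)[of "i - size1 l" "k - size1 l"] Node.prems by auto
  qed
qed simp

lemma lookup_lincomb_scale [simp]:
  "Poly_Mapping.lookup (lincomb_scale c f) t = c * Poly_Mapping.lookup f t"
  by (simp add: lincomb_scale_def Poly_Mapping.map.rep_eq when_def)

lemma lincomb_scale_single [simp]:
  "lincomb_scale c (Poly_Mapping.single t a) = Poly_Mapping.single t (c * a)"
  by (rule poly_mapping_eqI) (simp add: lookup_single when_def)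

lemma vector_space_lincomb_scale: "vector_space lincomb_scale"
  by unfold_locales (auto intro!: poly_mapping_eqI simp: lookup_add algebra_simps)

interpretation lincomb: vector_space lincomb_scale
  by (rule vector_space_lincomb_scale)

lemma free_component_iff:
  "f \<in> free_component n \<longleftrightarrow> (\<forall>t. Poly_Mapping.lookup f t \<noteq> 0 \<longrightarrow> size1 t = n)"
  by (auto simp: free_component_def in_keys_iff)

lemma single_free_component: "size1 t = n \<Longrightarrow> Poly_Mapping.single t c \<in> free_component n"
  by (auto simp: free_component_iff lookup_single when_def)

lemma subspace_free_component: "lincomb.subspace (free_component n)"
  by (rule lincomb.subspaceI) (auto simp: free_component_iff lookup_add, metis add.right_neutral)

lemma sum_single:
  fixes f :: "'a \<Rightarrow>\<^sub>0 'k::field"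
  shows "(\<Sum>t \<in> Poly_Mapping.keys f. Poly_Mapping.single t (Poly_Mapping.lookup f t)) = f"
  by (rule poly_mapping_eqI)
     (auto simp: lookup_sum lookup_single when_def in_keys_iff sum.delta)

lemma lincomb_induct [case_names zero single add]:
  fixes f :: "'a \<Rightarrow>\<^sub>0 'k::field"
  assumes "Q 0"
    and "\<And>t c. t \<in> Poly_Mapping.keys f \<Longrightarrow> Q (Poly_Mapping.single t c)"
    and "\<And>g h. Q g \<Longrightarrow> Q h \<Longrightarrow> Q (g + h)"
  shows "Q f"
proof -
  have "Q (\<Sum>t \<in> A. Poly_Mapping.single t (Poly_Mapping.lookup f t))"
    if "finite A" "A \<subseteq> Poly_Mapping.keys f" for A
    using that by (induction A rule: finite_induct) (auto intro: assms)
  from this[of "Poly_Mapping.keys f"] show ?thesis by (simp add: sum_single)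
qed

lemma free_induct [consumes 1, case_names zero single add]:
  assumes "f \<in> free_component n" and "Q 0"
    and "\<And>t c. size1 t = n \<Longrightarrow> Q (Poly_Mapping.single t c)"
    and "\<And>g h. Q g \<Longrightarrow> Q h \<Longrightarrow> Q (g + h)"
  shows "Q f"
  using assms(1) by (intro lincomb_induct[of Q f] assms) (auto simp: free_component_def)

lemma free_comp_superset:
  assumes "finite A" "Poly_Mapping.keys f \<subseteq> A" "finite B" "Poly_Mapping.keys g \<subseteq> B"
  shows "free_comp f i g = (\<Sum>t \<in> A. \<Sum>s \<in> B. if 1 \<le> i \<and> i \<le> size1 t
     then Poly_Mapping.single (graft t i s) (Poly_Mapping.lookup f t * Poly_Mapping.lookup g s)
     else 0)"
proof -
  have "free_comp f i g = (\<Sum>t \<in> Poly_Mapping.keys f. \<Sum>s \<in> B. if 1 \<le> i \<and> i \<le> size1 t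
     then Poly_Mapping.single (graft t i s) (Poly_Mapping.lookup f t * Poly_Mapping.lookup g s)
     else 0)"
    unfolding free_comp_def
    by (intro sum.cong refl sum.mono_neutral_left) (use assms in \<open>auto simp: in_keys_iff\<close>)
  also have "\<dots> = (\<Sum>t \<in> A. \<Sum>s \<in> B. if 1 \<le> i \<and> i \<le> size1 t
     then Poly_Mapping.single (graft t i s) (Poly_Mapping.lookup f t * Poly_Mapping.lookup g s)
     else 0)"
    by (intro sum.mono_neutral_left) (use assms in \<open>auto simp: in_keys_iff intro!: sum.neutral\<close>)
  finally show ?thesis .
qed

lemma free_comp_zero_left [simp]: "free_comp 0 i g = 0"
  and free_comp_zero_right [simp]: "free_comp f i 0 = 0"
  by (simp_all add: free_comp_def)

lemma free_comp_single [simp]: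
  "free_comp (Poly_Mapping.single t a) i (Poly_Mapping.single s b) =
     (if 1 \<le> i \<and> i \<le> size1 t then Poly_Mapping.single (graft t i s) (a * b) else 0)"
  by (subst free_comp_superset[of "{t}" _ "{s}"]) auto

lemma free_comp_add_left: "free_comp (f + f') i g = free_comp f i g + free_comp f' i g"
proof -
  let ?A = "Poly_Mapping.keys f \<union> Poly_Mapping.keys f'"
  note ex = free_comp_superset[of ?A _ "Poly_Mapping.keys g"]
  show ?thesis
    using keys_add[of f f']
    by (simp add: ex sum.distrib[symmetric])
       (intro sum.cong refl; simp add: lookup_add distrib_right single_add)
qed

lemma free_comp_add_right: "free_comp f i (g + g') = free_comp f i g + free_comp f i g'"
proof -
  let ?B = "Poly_Mapping.keys g \<union> Poly_Mapping.keys g'"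
  note ex = free_comp_superset[of "Poly_Mapping.keys f" _ ?B]
  show ?thesis
    using keys_add[of g g']
    by (simp add: ex sum.distrib[symmetric])
       (intro sum.cong refl; simp add: lookup_add distrib_left single_add)
qed

lemma free_comp_scale_left: "free_comp (lincomb_scale c f) i g = lincomb_scale c (free_comp f i g)"
proof (induction f rule: lincomb_induct)
  case (single t a)
  show ?case
    by (induction g rule: lincomb_induct)
       (auto simp: free_comp_add_right lincomb.scale_right_distrib mult.assoc)
qed (auto simp: free_comp_add_left lincomb.scale_right_distrib)

lemma free_comp_scale_right: "free_comp f i (lincomb_scale c g) = lincomb_scale c (free_comp f i g)"
proof (induction f rule: lincomb_induct)
  case (single t a)
  show ?case
    by (induction g rule: lincomb_induct)
       (auto simp: free_comp_add_right lincomb.scale_right_distrib mult.left_commute)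
qed (auto simp: free_comp_add_left lincomb.scale_right_distrib)

lemma free_comp_out_of_range:
  assumes "f \<in> free_component m" "\<not> (1 \<le> i \<and> i \<le> m)"
  shows "free_comp f i g = 0"
  using assms by (auto simp: free_comp_def free_component_def intro!: sum.neutral)

lemma free_comp_closed:
  assumes "f \<in> free_component m" "g \<in> free_component n" "1 \<le> i" "i \<le> m"
  shows "free_comp f i g \<in> free_component (m + n - 1)"
  using assms(1)
proof (induction rule: free_induct)
  case (single t a)
  from assms(2) show ?case
    using single assms(3,4)
    by (induction rule: free_induct)
       (auto simp: free_comp_add_right size1_graft lincomb.subspace_0[OF subspace_free_component]
          intro!: single_free_component lincomb.subspace_add[OF subspace_free_component])
qed (auto simp: free_comp_add_left lincomb.subspace_0[OF subspace_free_component]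
       intro: lincomb.subspace_add[OF subspace_free_component])

lemma ns_operad_free: "ns_operad lincomb_scale free_component free_comp free_unit"
proof unfold_locales
  fix f g h :: "'g tree \<Rightarrow>\<^sub>0 'k::field" and i j k l m n :: nat
  show "free_comp f i g \<in> free_component (m + n - 1)"
    if "f \<in> free_component m" "g \<in> free_component n" "1 \<le> i" "i \<le> m"
    using that by (rule free_comp_closed)
  show "free_comp free_unit 1 g = g"
    by (induction g rule: lincomb_induct) (auto simp: free_unit_def free_comp_add_right)
  show "free_comp f i free_unit = f" if "f \<in> free_component m" "1 \<le> i" "i \<le> m"
    using that(1)
    by (induction rule: free_induct)
       (use that in \<open>auto simp: free_unit_def free_comp_add_left graft_Leaf\<close>)
  show "free_comp (free_comp f i g) (i - 1 + j) h = free_comp f i (free_comp g j h)"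
    if f: "f \<in> free_component l" and g: "g \<in> free_component m" and h: "h \<in> free_component n"
      and ij: "1 \<le> i" "i \<le> l" "1 \<le> j" "j \<le> m"
    using f
  proof (induction rule: free_induct)
    case t: (single t a)
    show ?case using g
    proof (induction rule: free_induct)
      case s: (single s b)
      show ?case using h
      proof (induction rule: free_induct)
        case u: (single u c)
        have "i - 1 + j \<le> size1 (graft t i s)" "1 \<le> i - 1 + j"
          using t s ij size1_graft[of i t s] by linarith+
        then show ?case
          using t s ij graft_sequential[of i t j s u] by (simp add: mult.assoc)
      qed (auto simp: free_comp_add_left free_comp_add_right)
    qed (auto simp: free_comp_add_left free_comp_add_right)
  qed (auto simp: free_comp_add_left free_comp_add_right)
  show "free_comp (free_comp f i g) (k - 1 + m) h = free_comp (free_comp f k h) i g"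
    if f: "f \<in> free_component l" and g: "g \<in> free_component m" and h: "h \<in> free_component n"
      and ik: "1 \<le> i" "i < k" "k \<le> l"
    using f
  proof (induction rule: free_induct)
    case t: (single t a)
    show ?case using g
    proof (induction rule: free_induct)
      case s: (single s b)
      show ?case using h
      proof (induction rule: free_induct)
        case u: (single u c)
        have "0 < size1 s" "0 < size1 u" by simp_all
        then show ?case
          using t s u ik graft_parallel[of i k t s u] size1_graft[of i t s] size1_graft[of k t u]
          by (auto simp: mult_ac)
      qed (auto simp: free_comp_add_left free_comp_add_right)
    qed (auto simp: free_comp_add_left free_comp_add_right)
  qed (auto simp: free_comp_add_left free_comp_add_right)
qed (auto simp: subspace_free_component free_comp_add_left free_comp_add_right
       free_comp_scale_left free_comp_scale_right free_unit_def single_free_component)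

interpretation free: ns_operad lincomb_scale free_component free_comp free_unit
  by (rule ns_operad_free)


section \<open>The nonsymmetric flexible operad\<close>

datatype flex_gen = Prec | Succ

definition left_comb :: "'g \<Rightarrow> 'g \<Rightarrow> 'g tree \<Rightarrow>\<^sub>0 'k::field" where
  \<comment> \<open>the monomial \<open>(x\<^sub>1 a x\<^sub>2) b x\<^sub>3\<close>\<close>
  "left_comb a b = Poly_Mapping.single (Node (Node Leaf a Leaf) b Leaf) 1"

definition right_comb :: "'g \<Rightarrow> 'g \<Rightarrow> 'g tree \<Rightarrow>\<^sub>0 'k::field" where
  \<comment> \<open>the monomial \<open>x\<^sub>1 a (x\<^sub>2 b x\<^sub>3)\<close>\<close>
  "right_comb a b = Poly_Mapping.single (Node Leaf a (Node Leaf b Leaf)) 1"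

definition flex_relation :: "flex_gen tree \<Rightarrow>\<^sub>0 'k::field" where
  "flex_relation = left_comb Succ Succ - right_comb Succ Succ
                 - left_comb Prec Prec + right_comb Prec Prec"

definition flex_ideal :: "nat \<Rightarrow> (flex_gen tree \<Rightarrow>\<^sub>0 'k::field) set" where
  "flex_ideal = free.generated_ideal (\<lambda>n. if n = 3 then {flex_relation} else {})"

definition flex_ideal_total :: "(flex_gen tree \<Rightarrow>\<^sub>0 'k::field) set" where
  "flex_ideal_total = lincomb.span (\<Union>n. flex_ideal n)"

lemma flex_relation_component: "flex_relation \<in> free_component 3"
  unfolding flex_relation_def left_comb_def right_comb_def
  by (intro lincomb.subspace_add lincomb.subspace_diff subspace_free_component
      single_free_component) simp_all

lemma operad_ideal_flex_ideal: "free.operad_ideal flex_ideal"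
  unfolding flex_ideal_def
  by (rule free.operad_ideal_generated_ideal) (simp add: flex_relation_component)

lemma flex_relation_ideal: "flex_relation \<in> flex_ideal 3"
  by (force simp: flex_ideal_def free.generated_ideal_def)

lemma subspace_flex_ideal_total: "lincomb.subspace flex_ideal_total"
  by (simp add: flex_ideal_total_def)

lemma flex_ideal_le_total: "f \<in> flex_ideal n \<Longrightarrow> f \<in> flex_ideal_total"
  unfolding flex_ideal_total_def by (rule lincomb.span_base) blast

lemma flex_ideal_total_comp_left:
  assumes "f \<in> flex_ideal_total"
  shows "free_comp f i g \<in> flex_ideal_total"
  using assms unfolding flex_ideal_total_def
proof (induction rule: lincomb.span_induct_alt)
  case base
  show ?case by (simp add: lincomb.span_zero)
next
  case (step c f h)
  then obtain m where f: "f \<in> flex_ideal m" by blast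
  have "free_comp f i g \<in> flex_ideal_total"
  proof (induction g rule: lincomb_induct)
    case (single s b)
    have g: "Poly_Mapping.single s b \<in> free_component (size1 s)"
      by (simp add: single_free_component)
    show ?case
    proof (cases "1 \<le> i \<and> i \<le> m")
      case True
      then show ?thesis
        using operad_ideal_flex_ideal f g flex_ideal_le_total
        unfolding free.operad_ideal_def by blast
    next
      case False
      have "f \<in> free_component m"
        using operad_ideal_flex_ideal f unfolding free.operad_ideal_def by blast
      then show ?thesis
        using False free_comp_out_of_range lincomb.subspace_0[OF subspace_flex_ideal_total] by metis
    qed
  qed (auto simp: free_comp_add_right lincomb.subspace_0[OF subspace_flex_ideal_total]
         intro: lincomb.subspace_add[OF subspace_flex_ideal_total])
  then show ?case
    using step unfolding flex_ideal_total_def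
    by (simp add: free_comp_add_left free_comp_scale_left lincomb.span_add lincomb.span_scale)
qed

lemma flex_ideal_total_comp_right:
  assumes "g \<in> flex_ideal_total"
  shows "free_comp f i g \<in> flex_ideal_total"
  using assms unfolding flex_ideal_total_def
proof (induction rule: lincomb.span_induct_alt)
  case base
  show ?case by (simp add: lincomb.span_zero)
next
  case (step c g h)
  then obtain n where g: "g \<in> flex_ideal n" by blast
  have "free_comp f i g \<in> flex_ideal_total"
  proof (induction f rule: lincomb_induct)
    case (single t a)
    have f: "Poly_Mapping.single t a \<in> free_component (size1 t)"
      by (simp add: single_free_component)
    show ?case
    proof (cases "1 \<le> i \<and> i \<le> size1 t")
      case True
      then show ?thesis
        using operad_ideal_flex_ideal f g flex_ideal_le_total
        unfolding free.operad_ideal_def by blast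
    next
      case False
      then show ?thesis
        using f free_comp_out_of_range lincomb.subspace_0[OF subspace_flex_ideal_total] by metis
    qed
  qed (auto simp: free_comp_add_left lincomb.subspace_0[OF subspace_flex_ideal_total]
         intro: lincomb.subspace_add[OF subspace_flex_ideal_total])
  then show ?case
    using step unfolding flex_ideal_total_def
    by (simp add: free_comp_add_right free_comp_scale_right lincomb.span_add lincomb.span_scale)
qed

(* The quotient of the whole ambient space, the direct sum of all arities; its component of arity n
   is the image of free_component n, i.e. free_component n / flex_ideal n. *)
quotient_type (overloaded) 'k flex =
    "flex_gen tree \<Rightarrow>\<^sub>0 'k::field" / "\<lambda>f g. f - g \<in> flex_ideal_total"
proof (rule equivpI)
  note S = subspace_flex_ideal_total
  show "reflp (\<lambda>f g :: flex_gen tree \<Rightarrow>\<^sub>0 'k. f - g \<in> flex_ideal_total)"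
    using lincomb.subspace_0[OF S] by (auto intro: reflpI)
  show "symp (\<lambda>f g :: flex_gen tree \<Rightarrow>\<^sub>0 'k. f - g \<in> flex_ideal_total)"
  proof (rule sympI)
    fix f g :: "flex_gen tree \<Rightarrow>\<^sub>0 'k"
    assume "f - g \<in> flex_ideal_total"
    from lincomb.subspace_neg[OF S this] show "g - f \<in> flex_ideal_total" by simp
  qed
  show "transp (\<lambda>f g :: flex_gen tree \<Rightarrow>\<^sub>0 'k. f - g \<in> flex_ideal_total)"
  proof (rule transpI)
    fix f g h :: "flex_gen tree \<Rightarrow>\<^sub>0 'k"
    assume "f - g \<in> flex_ideal_total" "g - h \<in> flex_ideal_total"
    from lincomb.subspace_add[OF S this] show "f - h \<in> flex_ideal_total" by simp
  qed
qed

instantiation flex :: (field) ab_group_add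
begin

lift_definition zero_flex :: "'k::field flex" is 0 .

lift_definition plus_flex :: "'k::field flex \<Rightarrow> 'k flex \<Rightarrow> 'k flex" is "(+)"
  using lincomb.subspace_add[OF subspace_flex_ideal_total] by (metis add_diff_add)

lift_definition uminus_flex :: "'k::field flex \<Rightarrow> 'k flex" is uminus
  using lincomb.subspace_neg[OF subspace_flex_ideal_total] by (metis minus_diff_minus)

lift_definition minus_flex :: "'k::field flex \<Rightarrow> 'k flex \<Rightarrow> 'k flex" is "(-)"
proof -
  fix f f' g g' :: "flex_gen tree \<Rightarrow>\<^sub>0 'k"
  assume "f - f' \<in> flex_ideal_total" "g - g' \<in> flex_ideal_total"
  moreover have "f - g - (f' - g') = (f - f') - (g - g')" by simp
  ultimately show "f - g - (f' - g') \<in> flex_ideal_total"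
    using lincomb.subspace_diff[OF subspace_flex_ideal_total] by metis
qed

instance
  by standard
    (transfer, simp add: algebra_simps lincomb.subspace_0[OF subspace_flex_ideal_total])+

end

lift_definition flex_scale :: "'k::field \<Rightarrow> 'k flex \<Rightarrow> 'k flex" is lincomb_scale
  using lincomb.subspace_scale[OF subspace_flex_ideal_total]
  by (metis lincomb.scale_right_diff_distrib)

lift_definition flex_comp :: "'k::field flex \<Rightarrow> nat \<Rightarrow> 'k flex \<Rightarrow> 'k flex" is free_comp
proof -
  fix f f' g g' :: "flex_gen tree \<Rightarrow>\<^sub>0 'k" and i
  assume "f - f' \<in> flex_ideal_total" "g - g' \<in> flex_ideal_total"
  moreover have "free_comp f i g - free_comp f' i g' = free_comp (f - f') i g + free_comp f' i (g - g')"
    using free_comp_add_left[of "f - f'" f' i g] free_comp_add_right[of f' i "g - g'" g'] by simp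
  ultimately show "free_comp f i g - free_comp f' i g' \<in> flex_ideal_total"
    using flex_ideal_total_comp_left flex_ideal_total_comp_right
      lincomb.subspace_add[OF subspace_flex_ideal_total] by metis
qed

lift_definition flex_unit :: "'k::field flex" is free_unit .

definition noncom_Flex :: "nat \<Rightarrow> 'k::field flex set" where
  "noncom_Flex n = abs_flex ` free_component n"

lemma vector_space_flex_scale: "vector_space flex_scale"
  by unfold_locales
     (transfer, simp add: lincomb.scale_right_distrib lincomb.scale_left_distrib
        lincomb.subspace_0[OF subspace_flex_ideal_total])+

lemma ns_operad_noncom_Flex: "ns_operad flex_scale noncom_Flex flex_comp flex_unit"
proof -
  note abs = zero_flex.abs_eq plus_flex.abs_eq flex_scale.abs_eq flex_comp.abs_eq flex_unit.abs_eq
  interpret flex: vector_space flex_scale by (rule vector_space_flex_scale)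
  show ?thesis
  proof unfold_locales
    show "flex.subspace (noncom_Flex n)" for n
    proof (rule flex.subspaceI)
      show "0 \<in> noncom_Flex n"
        unfolding noncom_Flex_def zero_flex.abs_eq
        by (rule imageI) (rule lincomb.subspace_0[OF subspace_free_component])
      show "x + y \<in> noncom_Flex n" if "x \<in> noncom_Flex n" "y \<in> noncom_Flex n" for x y
        using that lincomb.subspace_add[OF subspace_free_component]
        by (fastforce simp: noncom_Flex_def plus_flex.abs_eq)
      show "flex_scale c x \<in> noncom_Flex n" if "x \<in> noncom_Flex n" for c x
        using that lincomb.subspace_scale[OF subspace_free_component]
        by (fastforce simp: noncom_Flex_def flex_scale.abs_eq)
    qed
    show "flex_comp f i g \<in> noncom_Flex (m + n - 1)"
      if "f \<in> noncom_Flex m" "g \<in> noncom_Flex n" "1 \<le> i" "i \<le> m" for f g m n i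
      using that free_comp_closed by (fastforce simp: noncom_Flex_def flex_comp.abs_eq)
    show "flex_comp (flex_comp f i g) (i - 1 + j) h = flex_comp f i (flex_comp g j h)"
      if mem: "f \<in> noncom_Flex l" "g \<in> noncom_Flex m" "h \<in> noncom_Flex n"
        and range: "1 \<le> i" "i \<le> l" "1 \<le> j" "j \<le> m" for f g h l m n i j
    proof -
      obtain f' g' h' where *: "f = abs_flex f'" "g = abs_flex g'" "h = abs_flex h'"
        "f' \<in> free_component l" "g' \<in> free_component m" "h' \<in> free_component n"
        using mem by (auto simp: noncom_Flex_def)
      show ?thesis
        unfolding *(1-3) abs free.comp_sequential[OF *(4-6) range] ..
    qed
    show "flex_comp (flex_comp f i g) (k - 1 + m) h = flex_comp (flex_comp f k h) i g"
      if mem: "f \<in> noncom_Flex l" "g \<in> noncom_Flex m" "h \<in> noncom_Flex n"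
        and range: "1 \<le> i" "i < k" "k \<le> l" for f g h l m n i k
    proof -
      obtain f' g' h' where *: "f = abs_flex f'" "g = abs_flex g'" "h = abs_flex h'"
        "f' \<in> free_component l" "g' \<in> free_component m" "h' \<in> free_component n"
        using mem by (auto simp: noncom_Flex_def)
      show ?thesis
        unfolding *(1-3) abs free.comp_parallel[OF *(4-6) range] ..
    qed
    show "flex_unit \<in> noncom_Flex 1"
      unfolding noncom_Flex_def abs by (rule imageI) (rule free.unit_P)
    show "flex_comp flex_unit 1 g = g" if mem: "g \<in> noncom_Flex n" for g n
    proof -
      obtain g' where *: "g = abs_flex g'" "g' \<in> free_component n"
        using mem by (auto simp: noncom_Flex_def)
      show ?thesis
        unfolding *(1) abs free.comp_unit_left[OF *(2)] ..
    qed
  qed (auto simp: noncom_Flex_def abs free_comp_add_left free_comp_add_right free_comp_scale_left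
        free_comp_scale_right free.comp_unit_right)
qed

(* The ambient quotient introduces no identifications beyond flex_ideal n in arity n. *)
lemma abs_flex_eq_iff:
  assumes "f \<in> free_component n" "g \<in> free_component n"
  shows "abs_flex f = abs_flex g \<longleftrightarrow> f - g \<in> flex_ideal n"
proof -
  define pr :: "nat \<Rightarrow> (flex_gen tree \<Rightarrow>\<^sub>0 'a) \<Rightarrow> (flex_gen tree \<Rightarrow>\<^sub>0 'a)"
    where "pr n f = Poly_Mapping.mapp (\<lambda>t c. c when size1 t = n) f" for n f
  have lookup_pr: "Poly_Mapping.lookup (pr n f) t = (Poly_Mapping.lookup f t when size1 t = n)" for n f t
    by (simp add: pr_def lookup_mapp when_def in_keys_iff)
  have pr_id: "pr n f = f" if "f \<in> free_component n" for n f
    using that by (intro poly_mapping_eqI) (auto simp: lookup_pr when_def free_component_iff)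
  have pr_0: "pr n f = 0" if "f \<in> free_component m" "m \<noteq> n" for m n f
    using that by (intro poly_mapping_eqI) (auto simp: lookup_pr when_def free_component_iff)
  have sub: "lincomb.subspace (flex_ideal n :: (flex_gen tree \<Rightarrow>\<^sub>0 'a) set)"
    and le: "flex_ideal m \<subseteq> (free_component m :: (flex_gen tree \<Rightarrow>\<^sub>0 'a) set)" for n m
    using operad_ideal_flex_ideal unfolding free.operad_ideal_def by blast+
  have "pr n h \<in> flex_ideal n" if "h \<in> flex_ideal_total" for h
    using that unfolding flex_ideal_total_def
  proof (induction rule: lincomb.span_induct_alt)
    case base
    have "pr n 0 = 0" by (intro poly_mapping_eqI) (simp add: lookup_pr)
    then show ?case using lincomb.subspace_0[OF sub] by simp
  next
    case (step c x y)
    then obtain m where m: "x \<in> flex_ideal m" by blast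
    have "pr n x \<in> flex_ideal n"
    proof (cases "m = n")
      case True
      then show ?thesis using m le pr_id[of x n] by (metis subsetD)
    next
      case False
      then show ?thesis using m le pr_0[of x m n] lincomb.subspace_0[OF sub] by (metis subsetD)
    qed
    moreover have "pr n (lincomb_scale c x + y) = lincomb_scale c (pr n x) + pr n y"
      by (intro poly_mapping_eqI) (simp add: lookup_pr lookup_add when_def)
    ultimately show ?case
      using step lincomb.subspace_add[OF sub] lincomb.subspace_scale[OF sub] by metis
  qed
  moreover have "pr n (f - g) = f - g"
    using assms by (intro pr_id lincomb.subspace_diff[OF subspace_free_component])
  ultimately show ?thesis
    using flex_ideal_le_total by (auto simp: flex.abs_eq_iff) metis
qed

end

theory Submission
  imports Defs "HOL-Computational_Algebra.Formal_Power_Series"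
begin

text \<open>In terms of \<open>\<prec>\<close> and \<open>x * y = x \<succ> y - x \<prec> y\<close> the relation reads
  \<open>(x \<prec> y) * z = x \<prec> (y * z) + x * (y \<prec> z) + x * (y * z) - (x * y) \<prec> z - (x * y) * z\<close>.
  The monomial on the left does not overlap itself, so as a rewrite rule the relation is confluent;
  it terminates because every product \<open>*\<close> on the right has fewer \<open>\<prec>\<close> in its left argument. Hence
  the trees in which no \<open>\<prec>\<close> is the left child of a \<open>*\<close> form a basis. Confluence is proved by a
  model: the rewrite rule defines \<open>*\<close> recursively on linear combinations of trees, where the
  relation then holds identically, and multilinear evaluation of operations in this model
  annihilates the ideal. Splitting a basis tree at its root shows that the generating function \<open>F\<close>
  satisfies \<open>F = X + F\<^sup>2 + (F - F\<^sup>2) F\<close>, and the coefficients of all powers of \<open>F\<close> satisfy a linear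
  recurrence with the solution \<open>[X\<^sup>n] F\<^sup>r = r/n binom (3n-r-1) (n-r)\<close>.\<close>

section \<open>Linear and bilinear extension\<close>

definition lin_ext :: "('a \<Rightarrow> 'b \<Rightarrow>\<^sub>0 'k::field) \<Rightarrow> ('a \<Rightarrow>\<^sub>0 'k) \<Rightarrow> ('b \<Rightarrow>\<^sub>0 'k)" where
  "lin_ext h f = (\<Sum>t \<in> Poly_Mapping.keys f. lincomb_scale (Poly_Mapping.lookup f t) (h t))"

lemma lin_ext_superset:
  assumes "finite A" "Poly_Mapping.keys f \<subseteq> A"
  shows "lin_ext h f = (\<Sum>t \<in> A. lincomb_scale (Poly_Mapping.lookup f t) (h t))"
  unfolding lin_ext_def
  by (intro sum.mono_neutral_left) (use assms in \<open>auto simp: in_keys_iff\<close>)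

lemma lin_ext_zero [simp]: "lin_ext h 0 = 0"
  by (simp add: lin_ext_def)

lemma lin_ext_single [simp]: "lin_ext h (Poly_Mapping.single t c) = lincomb_scale c (h t)"
  by (subst lin_ext_superset[of "{t}"]) auto

lemma lin_ext_add: "lin_ext h (f + g) = lin_ext h f + lin_ext h g"
  using keys_add[of f g]
  by (simp add: lin_ext_superset[of "Poly_Mapping.keys f \<union> Poly_Mapping.keys g"]
      lookup_add lincomb.scale_left_distrib sum.distrib)

lemma keys_lincomb_scale: "Poly_Mapping.keys (lincomb_scale c f) \<subseteq> Poly_Mapping.keys f"
  by (auto simp: in_keys_iff)

lemma lin_ext_scale: "lin_ext h (lincomb_scale c f) = lincomb_scale c (lin_ext h f)"
  using keys_lincomb_scale[of c f]
  by (simp add: lin_ext_superset[of "Poly_Mapping.keys f"] lincomb.scale_sum_right)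

lemma lin_ext_diff: "lin_ext h (f - g) = lin_ext h f - lin_ext h g"
  using lin_ext_add[of h "f - g" g] by (simp add: algebra_simps)

lemma lin_ext_cong:
  "(\<And>t. t \<in> Poly_Mapping.keys f \<Longrightarrow> h t = h' t) \<Longrightarrow> lin_ext h f = lin_ext h' f"
  by (simp add: lin_ext_def)

lemma lin_ext_zero_fun [simp]: "lin_ext (\<lambda>t. 0) f = 0"
  by (simp add: lin_ext_def)

lemma lin_ext_add_fun: "lin_ext (\<lambda>t. h t + h' t) f = lin_ext h f + lin_ext h' f"
  by (simp add: lin_ext_def lincomb.scale_right_distrib sum.distrib)

lemma lin_ext_scale_fun: "lin_ext (\<lambda>t. lincomb_scale c (h t)) f = lincomb_scale c (lin_ext h f)"
  by (simp add: lin_ext_def lincomb.scale_sum_right mult.commute)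

lemma lin_ext_lin_ext: "lin_ext g (lin_ext h f) = lin_ext (\<lambda>t. lin_ext g (h t)) f"
  by (induction f rule: lincomb_induct) (simp_all add: lin_ext_add lin_ext_scale)

lemma lin_ext_monomials: "lin_ext (\<lambda>t. Poly_Mapping.single t 1) f = f"
  by (induction f rule: lincomb_induct) (simp_all add: lin_ext_add)

lemma keys_lin_ext_subset:
  "(\<And>t. t \<in> Poly_Mapping.keys f \<Longrightarrow> Poly_Mapping.keys (h t) \<subseteq> A)
    \<Longrightarrow> Poly_Mapping.keys (lin_ext h f) \<subseteq> A"
  unfolding lin_ext_def
  by (intro subset_trans[OF keys_sum] UN_least subset_trans[OF keys_lincomb_scale])

lemma keys_add_subset:
  "Poly_Mapping.keys f \<subseteq> A \<Longrightarrow> Poly_Mapping.keys g \<subseteq> A \<Longrightarrow> Poly_Mapping.keys (f + g) \<subseteq> A"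
  using keys_add[of f g] by blast

lemma keys_diff_subset:
  fixes f g :: "'a \<Rightarrow>\<^sub>0 'k::field"
  shows "Poly_Mapping.keys f \<subseteq> A \<Longrightarrow> Poly_Mapping.keys g \<subseteq> A \<Longrightarrow> Poly_Mapping.keys (f - g) \<subseteq> A"
  using keys_diff[of f g] by blast

text \<open>The order of the two extensions is fixed: the first argument is expanded outside, the
  second inside. Linearity in the second therefore comes from the \<open>lin_ext_add_fun\<close> and
  \<open>lin_ext_scale_fun\<close> rules.\<close>

definition bilin_ext ::
  "('a \<Rightarrow> 'b \<Rightarrow> 'c \<Rightarrow>\<^sub>0 'k::field) \<Rightarrow> ('a \<Rightarrow>\<^sub>0 'k) \<Rightarrow> ('b \<Rightarrow>\<^sub>0 'k) \<Rightarrow> ('c \<Rightarrow>\<^sub>0 'k)" where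
  "bilin_ext h f g = lin_ext (\<lambda>t. lin_ext (h t) g) f"

lemma bilin_ext_zero_left [simp]: "bilin_ext h 0 g = 0"
  and bilin_ext_zero_right [simp]: "bilin_ext h f 0 = 0"
  and bilin_ext_add_left: "bilin_ext h (f + f') g = bilin_ext h f g + bilin_ext h f' g"
  and bilin_ext_add_right: "bilin_ext h f (g + g') = bilin_ext h f g + bilin_ext h f g'"
  and bilin_ext_scale_left: "bilin_ext h (lincomb_scale c f) g = lincomb_scale c (bilin_ext h f g)"
  and bilin_ext_scale_right: "bilin_ext h f (lincomb_scale c g) = lincomb_scale c (bilin_ext h f g)"
  and bilin_ext_single:
    "bilin_ext h (Poly_Mapping.single t a) (Poly_Mapping.single s b) = lincomb_scale (a * b) (h t s)"
  by (simp_all add: bilin_ext_def lin_ext_add lin_ext_add_fun lin_ext_scale lin_ext_scale_fun)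

lemmas bilin_ext_simps = bilin_ext_add_left bilin_ext_add_right bilin_ext_scale_left
  bilin_ext_scale_right bilin_ext_single

definition node :: "'g \<Rightarrow> ('g tree \<Rightarrow>\<^sub>0 'k::field) \<Rightarrow> ('g tree \<Rightarrow>\<^sub>0 'k) \<Rightarrow> ('g tree \<Rightarrow>\<^sub>0 'k)" where
  "node g = bilin_ext (\<lambda>t s. Poly_Mapping.single (Node t g s) 1)"

section \<open>The rewriting model\<close>

fun prec_count :: "flex_gen tree \<Rightarrow> nat" where
  "prec_count Leaf = 0"
| "prec_count (Node l g r) = prec_count l + (if g = Prec then 1 else 0) + prec_count r"

text \<open>A \<open>Succ\<close> node of a tree in the model stands for \<open>*\<close>, not for \<open>\<succ>\<close>. The first argument
  bounds the recursion depth; it is irrelevant once it is at least \<open>prec_count\<close> of the second.\<close>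

fun star_aux :: "nat \<Rightarrow> flex_gen tree \<Rightarrow> flex_gen tree \<Rightarrow> flex_gen tree \<Rightarrow>\<^sub>0 'k::field" where
  "star_aux (Suc n) (Node x Prec y) z =
      lin_ext (\<lambda>u. Poly_Mapping.single (Node x Prec u) 1) (star_aux n y z)
    + star_aux n x (Node y Prec z)
    + lin_ext (star_aux n x) (star_aux n y z)
    - lin_ext (\<lambda>u. Poly_Mapping.single (Node u Prec z) 1) (star_aux n x y)
    - lin_ext (\<lambda>u. star_aux n u z) (star_aux n x y)"
| "star_aux n t z = Poly_Mapping.single (Node t Succ z) 1"

text \<open>Each term on the right of the rule contains as many \<open>Prec\<close> as the left side
  or fewer. This bounds the trees in \<open>star_aux n x y\<close>, which become left arguments of
  further calls.\<close>

lemma star_aux_prec_count: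
  "Poly_Mapping.keys (star_aux n t s :: flex_gen tree \<Rightarrow>\<^sub>0 'k::field)
     \<subseteq> {u. prec_count u \<le> prec_count t + prec_count s}"
proof (induction n t s rule: star_aux.induct)
  case (1 n x y z)
  have yz: "prec_count u \<le> prec_count y + prec_count z"
    if "u \<in> Poly_Mapping.keys (star_aux n y z :: _ \<Rightarrow>\<^sub>0 'k)" for u
    using subsetD[OF 1(1) that] by simp
  have xy: "prec_count u \<le> prec_count x + prec_count y"
    if "u \<in> Poly_Mapping.keys (star_aux n x y :: _ \<Rightarrow>\<^sub>0 'k)" for u
    using subsetD[OF 1(5) that] by simp
  have a: "prec_count v \<le> prec_count x + prec_count u"
    if "v \<in> Poly_Mapping.keys (star_aux n x u :: _ \<Rightarrow>\<^sub>0 'k)" for u v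
    using subsetD[OF 1(3) that] by simp
  have b: "prec_count v \<le> prec_count u + prec_count z"
    if "v \<in> Poly_Mapping.keys (star_aux n u z :: _ \<Rightarrow>\<^sub>0 'k)" for u v
    using subsetD[OF 1(6) that] by simp
  show ?case
    unfolding star_aux.simps
  proof (intro keys_diff_subset keys_add_subset keys_lin_ext_subset, goal_cases)
    case 1
    then show ?case by (auto dest!: yz)
  next
    case 2
    show ?case by (auto dest!: a)
  next
    case 3
    then show ?case by (auto dest!: yz a)
  next
    case 4
    then show ?case by (auto dest!: xy)
  next
    case 5
    then show ?case by (auto dest!: xy b)
  qed
qed simp_all

lemma star_aux_not_Prec:
  assumes "\<And>x y. t \<noteq> Node x Prec y"
  shows "star_aux n t z = Poly_Mapping.single (Node t Succ z) 1"
proof (cases t)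
  case Leaf
  then show ?thesis by (cases n) simp_all
next
  case (Node x g y)
  then have "g = Succ" using assms by (cases g) auto
  then show ?thesis using Node by (cases n) simp_all
qed

lemma star_aux_fuel:
  "prec_count t \<le> n \<Longrightarrow> prec_count t \<le> m \<Longrightarrow> star_aux n t s = (star_aux m t s :: _ \<Rightarrow>\<^sub>0 'k::field)"
proof (induction n arbitrary: m t s)
  case 0
  then have "t \<noteq> Node x Prec y" for x y by auto
  then show ?case by (simp add: star_aux_not_Prec)
next
  case (Suc n)
  show ?case
  proof (cases "\<exists>x y. t = Node x Prec y")
    case True
    then obtain x y where t: "t = Node x Prec y" by blast
    then obtain m' where m: "m = Suc m'" using Suc.prems by (cases m) auto
    \<comment> \<open>The bound covers every left argument in the recursion, including trees of
      \<open>star_aux m' x y\<close>; it is one less than the count of \<open>t\<close>, hence at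
      most both \<open>n\<close> and \<open>m'\<close>.\<close>
    have eq: "star_aux n u w = (star_aux m' u w :: _ \<Rightarrow>\<^sub>0 'k)"
      if "prec_count u \<le> prec_count x + prec_count y" for u w
      using that t m Suc.prems by (intro Suc.IH) auto
    have xy: "prec_count u \<le> prec_count x + prec_count y"
      if "u \<in> Poly_Mapping.keys (star_aux m' x y :: _ \<Rightarrow>\<^sub>0 'k)" for u
      using that star_aux_prec_count by blast
    have "lin_ext (star_aux n x) f = lin_ext (star_aux m' x) f" for f :: "_ \<Rightarrow>\<^sub>0 'k"
      by (rule lin_ext_cong) (simp add: eq)
    moreover have "lin_ext (\<lambda>u. star_aux n u s) (star_aux m' x y) =
        lin_ext (\<lambda>u. star_aux m' u s) (star_aux m' x y :: _ \<Rightarrow>\<^sub>0 'k)"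
      by (rule lin_ext_cong) (simp add: eq xy)
    ultimately show ?thesis
      by (simp add: t m eq)
  next
    case False
    then show ?thesis by (simp add: star_aux_not_Prec)
  qed
qed

definition star :: "flex_gen tree \<Rightarrow> flex_gen tree \<Rightarrow> flex_gen tree \<Rightarrow>\<^sub>0 'k::field" where
  "star t s = star_aux (prec_count t) t s"

lemma star_Leaf [simp]: "star Leaf s = Poly_Mapping.single (Node Leaf Succ s) 1"
  and star_Succ [simp]: "star (Node x Succ y) s = Poly_Mapping.single (Node (Node x Succ y) Succ s) 1"
  by (simp_all add: star_def star_aux_not_Prec)

text \<open>The rewrite rule freed from the depth bound. From here on only this equation and the two
  non-rewriting cases of \<open>star\<close> matter.\<close>

lemma star_Prec:
  "star (Node x Prec y) z =
      (lin_ext (\<lambda>u. Poly_Mapping.single (Node x Prec u) 1) (star y z)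
    + star x (Node y Prec z)
    + lin_ext (star x) (star y z)
    - lin_ext (\<lambda>u. Poly_Mapping.single (Node u Prec z) 1) (star x y)
    - lin_ext (\<lambda>u. star u z) (star x y) :: _ \<Rightarrow>\<^sub>0 'k::field)"
proof -
  \<comment> \<open>One less than the count of \<open>Node x Prec y\<close>, and enough for all five
    recursive terms.\<close>
  define n where "n = prec_count x + prec_count y"
  have le: "prec_count x \<le> n" "prec_count y \<le> n" by (simp_all add: n_def)
  have eq: "star_aux n u w = (star u w :: _ \<Rightarrow>\<^sub>0 'k)" if "prec_count u \<le> n" for u w
    unfolding star_def using that by (intro star_aux_fuel) auto
  have "lin_ext (\<lambda>u. star_aux n u z) (star x y) = lin_ext (\<lambda>u. star u z) (star x y :: _ \<Rightarrow>\<^sub>0 'k)"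
    using star_aux_prec_count by (intro lin_ext_cong eq) (fastforce simp: star_def n_def)
  moreover have "lin_ext (star_aux n x) f = lin_ext (star x) f" for f :: "_ \<Rightarrow>\<^sub>0 'k"
    by (rule lin_ext_cong) (simp add: eq le)
  moreover have "star (Node x Prec y) z = (star_aux (Suc n) (Node x Prec y) z :: _ \<Rightarrow>\<^sub>0 'k)"
    by (simp add: star_def n_def)
  ultimately show ?thesis
    by (simp add: eq le)
qed

lemma star_prec_count:
  "u \<in> Poly_Mapping.keys (star t s :: flex_gen tree \<Rightarrow>\<^sub>0 'k::field)
     \<Longrightarrow> prec_count u \<le> prec_count t + prec_count s"
  using star_aux_prec_count unfolding star_def by blast

section \<open>Irreducible trees of the rewrite rule\<close>

fun normal :: "flex_gen tree \<Rightarrow> bool" where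
  "normal Leaf = True"
| "normal (Node l g r) =
     (normal l \<and> normal r \<and> (g = Succ \<longrightarrow> (case l of Node _ h _ \<Rightarrow> h = Succ | Leaf \<Rightarrow> True)))"

text \<open>The hypothesis ranges over all left arguments of bounded count instead of the subtrees
  \<open>x\<close> and \<open>y\<close>, because \<open>star_Prec\<close> also multiplies trees
  occurring in \<open>star x y\<close>.\<close>

lemma star_induct [case_names Leaf Succ Prec]:
  assumes "\<And>s. Q Leaf s"
    and "\<And>x y s. Q (Node x Succ y) s"
    and "\<And>x y z. (\<And>u s. prec_count u \<le> prec_count x + prec_count y \<Longrightarrow> Q u s)
      \<Longrightarrow> Q (Node x Prec y) z"
  shows "Q t s"
proof (induction t arbitrary: s rule: measure_induct_rule[where f = prec_count])
  case (less t)
  show ?case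
  proof (cases t)
    case (Node x g y)
    with less assms show ?thesis by (cases g) auto
  qed (simp add: assms)
qed

text \<open>Each term of the rule keeps the leaves. It builds either a \<open>Prec\<close> node,
  which is normal as soon as its children are, or a further \<open>star\<close>, to which the
  induction applies.\<close>

lemma keys_star:
  "Poly_Mapping.keys (star t s :: flex_gen tree \<Rightarrow>\<^sub>0 'k::field)
     \<subseteq> {u. size1 u = size1 t + size1 s \<and> (normal t \<and> normal s \<longrightarrow> normal u)}"
proof (induction t s rule: star_induct)
  case (Prec x y z)
  let ?K = "\<lambda>t s. Poly_Mapping.keys (star t s :: flex_gen tree \<Rightarrow>\<^sub>0 'k)"
  let ?S = "\<lambda>u t s. size1 u = size1 t + size1 s \<and> (normal t \<and> normal s \<longrightarrow> normal u)"
  have xy: "prec_count u \<le> prec_count x + prec_count y" if "u \<in> ?K x y" for u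
    using that star_prec_count by blast
  have IH: "?S v u s" if "v \<in> ?K u s" "prec_count u \<le> prec_count x + prec_count y" for u v s
    using subsetD[OF Prec[OF that(2)] that(1)] by simp
  have x: "?S v x s" if "v \<in> ?K x s" for v s using IH[OF that] by simp
  have y: "?S v y s" if "v \<in> ?K y s" for v s using IH[OF that] by simp
  show ?case
    unfolding star_Prec
  proof (intro keys_diff_subset keys_add_subset keys_lin_ext_subset, goal_cases)
    case (1 u)
    from y[OF 1] show ?case by auto
  next
    case 2
    show ?case by (auto dest!: x)
  next
    case (3 u)
    from y[OF 3] show ?case by (auto dest!: x)
  next
    case (4 u)
    from x[OF 4] show ?case by auto
  next
    case (5 u)
    from x[OF 5] IH[OF _ xy[OF 5]] show ?case by auto
  qed
qed auto

text \<open>Undoes the change of generators: \<open>Succ\<close> of the operad is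
  \<open>Prec\<close> plus \<open>*\<close>, where \<open>*\<close> is the rewriting product
  \<open>star\<close>.\<close>

definition mult :: "flex_gen \<Rightarrow> (flex_gen tree \<Rightarrow>\<^sub>0 'k::field) \<Rightarrow> (flex_gen tree \<Rightarrow>\<^sub>0 'k) \<Rightarrow> (flex_gen tree \<Rightarrow>\<^sub>0 'k)" where
  "mult g a b = node Prec a b + (if g = Succ then bilin_ext star a b else 0)"

lemma mult_add_left: "mult g (a + a') b = mult g a b + mult g a' b"
  and mult_add_right: "mult g a (b + b') = mult g a b + mult g a b'"
  and mult_scale_left: "mult g (lincomb_scale c a) b = lincomb_scale c (mult g a b)"
  and mult_scale_right: "mult g a (lincomb_scale c b) = lincomb_scale c (mult g a b)"
  by (simp_all add: mult_def node_def bilin_ext_simps lincomb.scale_right_distrib algebra_simps)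

text \<open>Both sides are trilinear, so only monomials need checking, where this is
  \<open>star_Prec\<close>.\<close>

lemma bilin_star_Prec:
  "bilin_ext star (node Prec a b) c =
      node Prec a (bilin_ext star b c) + bilin_ext star a (node Prec b c)
    + bilin_ext star a (bilin_ext star b c)
    - node Prec (bilin_ext star a b) c - bilin_ext star (bilin_ext star a b) c"
proof (induction a rule: lincomb_induct)
  case x: (single x p)
  show ?case
  proof (induction b rule: lincomb_induct)
    case y: (single y q)
    show ?case
    proof (induction c rule: lincomb_induct)
      case z: (single z r)
      show ?case
        by (simp add: node_def bilin_ext_def lin_ext_scale lin_ext_scale_fun star_Prec
            lincomb.scale_right_distrib lincomb.scale_right_diff_distrib
            lin_ext_lin_ext mult_ac flip: lincomb_scale_single)
    qed (simp_all add: node_def bilin_ext_add_left bilin_ext_add_right)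
  qed (simp_all add: node_def bilin_ext_add_left bilin_ext_add_right)
qed (simp_all add: node_def bilin_ext_add_left bilin_ext_add_right)

text \<open>After expanding \<open>Succ\<close> into \<open>Prec\<close> plus \<open>star\<close>,
  the two pure \<open>Prec\<close> monomials cancel and the rest is
  \<open>bilin_star_Prec\<close>.\<close>

lemma mult_flexible:
  "mult Succ (mult Succ a b) c - mult Succ a (mult Succ b c)
     - mult Prec (mult Prec a b) c + mult Prec a (mult Prec b c) = 0"
  by (simp add: mult_def bilin_ext_add_left bilin_ext_add_right bilin_star_Prec)
     (simp add: node_def bilin_ext_add_left bilin_ext_add_right)

lemma mult_zero_left [simp]: "mult g 0 b = 0"
  and mult_zero_right [simp]: "mult g a 0 = 0"
  by (simp_all add: mult_def node_def)

lemma keys_bilin_ext_subset: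
  assumes "\<And>t s. t \<in> Poly_Mapping.keys f \<Longrightarrow> s \<in> Poly_Mapping.keys g \<Longrightarrow> Poly_Mapping.keys (h t s) \<subseteq> A"
  shows "Poly_Mapping.keys (bilin_ext h f g) \<subseteq> A"
  unfolding bilin_ext_def by (intro keys_lin_ext_subset assms)

definition normal_trees :: "nat \<Rightarrow> flex_gen tree set" where
  "normal_trees n = {t. size1 t = n \<and> normal t}"

lemma keys_mult:
  assumes "Poly_Mapping.keys a \<subseteq> normal_trees m" "Poly_Mapping.keys b \<subseteq> normal_trees n"
  shows "Poly_Mapping.keys (mult g a b) \<subseteq> normal_trees (m + n)"
proof -
  have "Poly_Mapping.keys (node Prec a b) \<subseteq> normal_trees (m + n)"
    unfolding node_def
    by (rule keys_bilin_ext_subset) (use assms in \<open>auto simp: normal_trees_def\<close>)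
  moreover have "Poly_Mapping.keys (bilin_ext star a b) \<subseteq> normal_trees (m + n)"
  proof (rule keys_bilin_ext_subset)
    fix t s assume "t \<in> Poly_Mapping.keys a" "s \<in> Poly_Mapping.keys b"
    then have "t \<in> normal_trees m" "s \<in> normal_trees n" using assms by auto
    then show "Poly_Mapping.keys (star t s :: _ \<Rightarrow>\<^sub>0 'a) \<subseteq> normal_trees (m + n)"
      by (intro subset_trans[OF keys_star]) (auto simp: normal_trees_def)
  qed
  ultimately show ?thesis
    by (simp add: mult_def keys_add_subset)
qed

section \<open>Evaluation annihilates the ideal\<close>

text \<open>A tree read as an operation on the model. Inputs are numbered from 0 here, but from 1 in
  \<open>graft\<close>; the right subtree sees the inputs after those of \<open>l\<close>.\<close>

fun eval_tree :: "flex_gen tree \<Rightarrow> (nat \<Rightarrow> flex_gen tree \<Rightarrow>\<^sub>0 'k::field) \<Rightarrow> flex_gen tree \<Rightarrow>\<^sub>0 'k" where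
  "eval_tree Leaf e = e 0"
| "eval_tree (Node l g r) e = mult g (eval_tree l e) (eval_tree r (\<lambda>i. e (i + size1 l)))"

lemma eval_tree_cong:
  "(\<And>j. j < size1 t \<Longrightarrow> e j = e' j) \<Longrightarrow> eval_tree t e = eval_tree t e'"
proof (induction t arbitrary: e e')
  case (Node l g r)
  have "eval_tree l e = eval_tree l e'"
    using Node.prems by (intro Node.IH(1)) auto
  moreover have "eval_tree r (\<lambda>i. e (i + size1 l)) = eval_tree r (\<lambda>i. e' (i + size1 l))"
    using Node.prems by (intro Node.IH(2)) auto
  ultimately show ?case by simp
qed simp

text \<open>A leaf lies in exactly one of the two subtrees; this drives the induction for
  multilinearity.\<close>

lemma eval_tree_upd_Node:
  "eval_tree (Node l g r) (e(k := v)) =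
     (if k < size1 l then mult g (eval_tree l (e(k := v))) (eval_tree r (\<lambda>i. e (i + size1 l)))
      else mult g (eval_tree l e) (eval_tree r ((\<lambda>i. e (i + size1 l))(k - size1 l := v))))"
proof (cases "k < size1 l")
  case True
  then have "(\<lambda>i. (e(k := v)) (i + size1 l)) = (\<lambda>i. e (i + size1 l))" by (auto simp: fun_eq_iff)
  then show ?thesis using True by simp
next
  case False
  then have "(\<lambda>i. (e(k := v)) (i + size1 l)) = (\<lambda>i. e (i + size1 l))(k - size1 l := v)"
    by (auto simp: fun_eq_iff)
  moreover have "eval_tree l (e(k := v)) = eval_tree l e"
    using False by (intro eval_tree_cong) auto
  ultimately show ?thesis using False by simp
qed

lemma eval_tree_upd_add:
  "k < size1 t \<Longrightarrow> eval_tree t (e(k := v + w)) = eval_tree t (e(k := v)) + eval_tree t (e(k := w))"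
proof (induction t arbitrary: e k)
  case (Node l g r)
  then show ?case
    by (cases "k < size1 l")
       (auto simp: eval_tree_upd_Node mult_add_left mult_add_right simp del: eval_tree.simps fun_upd_apply)
qed simp

lemma eval_tree_upd_scale:
  "k < size1 t \<Longrightarrow> eval_tree t (e(k := lincomb_scale c v)) = lincomb_scale c (eval_tree t (e(k := v)))"
proof (induction t arbitrary: e k)
  case (Node l g r)
  then show ?case
    by (cases "k < size1 l")
       (auto simp: eval_tree_upd_Node mult_scale_left mult_scale_right simp del: eval_tree.simps fun_upd_apply)
qed simp

text \<open>The inputs of \<open>t\<close> seen after its leaf \<open>i\<close> is replaced by a
  tree with \<open>n\<close> leaves and value \<open>v\<close>: later inputs move by
  \<open>n - 1\<close>.\<close>

definition plug ::
    "nat \<Rightarrow> nat \<Rightarrow> 'v \<Rightarrow> (nat \<Rightarrow> 'v) \<Rightarrow> nat \<Rightarrow> 'v" where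
  "plug i n v e = (\<lambda>j. if Suc j < i then e j else if Suc j = i then v else e (j + n - 1))"

text \<open>Presents \<open>plug\<close> as a function update, so that linearity in \<open>v\<close>
  follows from linearity under updates.\<close>

lemma plug_upd: "1 \<le> i \<Longrightarrow> (plug i n w e)(i - Suc 0 := v) = plug i n v e"
  by (auto simp: plug_def fun_eq_iff)

lemma eval_tree_plug_add:
  "1 \<le> i \<Longrightarrow> i \<le> size1 t \<Longrightarrow>
     eval_tree t (plug i n (v + w) e) = eval_tree t (plug i n v e) + eval_tree t (plug i n w e)"
  using eval_tree_upd_add[of "i - 1" t "plug i n 0 e" v w]
  by (simp add: plug_upd)

lemma eval_tree_plug_scale:
  "1 \<le> i \<Longrightarrow> i \<le> size1 t \<Longrightarrow>
     eval_tree t (plug i n (lincomb_scale c v) e) = lincomb_scale c (eval_tree t (plug i n v e))"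
  using eval_tree_upd_scale[of "i - 1" t "plug i n 0 e" c v]
  by (simp add: plug_upd)

lemma eval_tree_plug_zero:
  "1 \<le> i \<Longrightarrow> i \<le> size1 t \<Longrightarrow> eval_tree t (plug i n 0 e) = 0"
  using eval_tree_plug_scale[of i t n 0 0 e] by simp

text \<open>Grafting is substitution: the value of \<open>s\<close> on its own block of inputs is
  fed into leaf \<open>i\<close> of \<open>t\<close>.\<close>

lemma eval_tree_graft:
  "1 \<le> i \<Longrightarrow> i \<le> size1 t \<Longrightarrow>
     eval_tree (graft t i s) e = eval_tree t (plug i (size1 s) (eval_tree s (\<lambda>j. e (j + (i - 1)))) e)"
proof (induction t arbitrary: i e)
  case Leaf
  then show ?case by (simp add: plug_def)
next
  case (Node l g r)
  have pos: "0 < size1 s" "0 < size1 l" by simp_all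
  let ?v = "eval_tree s (\<lambda>j. e (j + (i - 1)))"
  show ?case
  proof (cases "i \<le> size1 l")
    case True
    \<comment> \<open>The grafted left subtree has \<open>size1 l + size1 s - 1\<close> leaves,
      which is the displacement that \<open>plug\<close> gives to leaves beyond
      \<open>i\<close>.\<close>
    have "(\<lambda>j. e (j + size1 (graft l i s))) = (\<lambda>j. plug i (size1 s) ?v e (j + size1 l))"
      using True Node.prems pos size1_graft[of i l s]
      by (auto simp: plug_def fun_eq_iff add.assoc)
    then show ?thesis using True Node by simp
  next
    case False
    have "eval_tree l e = eval_tree l (plug i (size1 s) ?v e)"
      using False by (intro eval_tree_cong) (auto simp: plug_def)
    \<comment> \<open>Seen from \<open>r\<close>, the slot \<open>i\<close> has number
      \<open>i - size1 l\<close> and all inputs start \<open>size1 l\<close> later.\<close>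
    moreover have "(\<lambda>j. plug i (size1 s) ?v e (j + size1 l)) =
        plug (i - size1 l) (size1 s) ?v (\<lambda>j. e (j + size1 l))"
    proof
      fix j
      have "j + size1 l + size1 s - 1 = j + size1 s - 1 + size1 l" using pos by linarith
      then show "plug i (size1 s) ?v e (j + size1 l) =
          plug (i - size1 l) (size1 s) ?v (\<lambda>j. e (j + size1 l)) j"
        using False by (auto simp: plug_def)
    qed
    moreover have "eval_tree s (\<lambda>j. e (j + (i - size1 l - 1) + size1 l)) = ?v"
      using False by (intro eval_tree_cong arg_cong[of _ _ e]) simp
    ultimately show ?thesis
      using False Node.prems Node.IH(2)[of "i - size1 l" "\<lambda>j. e (j + size1 l)"] by simp
  qed
qed

definition eval :: "(flex_gen tree \<Rightarrow>\<^sub>0 'k) \<Rightarrow> (nat \<Rightarrow> flex_gen tree \<Rightarrow>\<^sub>0 'k::field) \<Rightarrow> flex_gen tree \<Rightarrow>\<^sub>0 'k" where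
  "eval f e = lin_ext (\<lambda>t. eval_tree t e) f"

lemma eval_simps [simp]:
  "eval 0 e = 0" "eval (f + g) e = eval f e + eval g e" "eval (f - g) e = eval f e - eval g e"
  "eval (lincomb_scale c f) e = lincomb_scale c (eval f e)"
  "eval (Poly_Mapping.single t c) e = lincomb_scale c (eval_tree t e)"
  by (simp_all add: eval_def lin_ext_add lin_ext_diff lin_ext_scale)

lemma eval_free_comp_single_right:
  assumes "f \<in> free_component m" "1 \<le> i" "i \<le> m"
  shows "eval (free_comp f i (Poly_Mapping.single s b)) e =
    lincomb_scale b (eval f (plug i (size1 s) (eval_tree s (\<lambda>j. e (j + (i - 1)))) e))"
  using assms(1)
  by (induction rule: free_induct)
     (use assms in \<open>auto simp: free_comp_add_left lincomb.scale_right_distrib eval_tree_graft mult.commute\<close>)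

lemma eval_free_comp_single_left:
  assumes "g \<in> free_component n" "1 \<le> i" "i \<le> size1 t"
  shows "eval (free_comp (Poly_Mapping.single t a) i g) e =
    lincomb_scale a (eval_tree t (plug i n (eval g (\<lambda>j. e (j + (i - 1)))) e))"
  using assms(1)
  by (induction rule: free_induct)
     (use assms in \<open>auto simp: free_comp_add_right lincomb.scale_right_distrib eval_tree_graft
        eval_tree_plug_add eval_tree_plug_zero eval_tree_plug_scale\<close>)

text \<open>Vanishing is required for all assignments \<open>e\<close>: composition changes the
  assignment, so a single fixed one would not obviously give an ideal.\<close>

definition eval_kernel :: "nat \<Rightarrow> (flex_gen tree \<Rightarrow>\<^sub>0 'k::field) set" where
  "eval_kernel n = {f \<in> free_component n. \<forall>e. eval f e = 0}"

lemma subspace_eval_kernel: "lincomb.subspace (eval_kernel n)"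
  by (rule lincomb.subspaceI)
     (auto simp: eval_kernel_def intro: lincomb.subspace_0[OF subspace_free_component]
        lincomb.subspace_add[OF subspace_free_component] lincomb.subspace_scale[OF subspace_free_component])

text \<open>If the outer operation vanishes identically, so does its value at the plugged
  assignment; if the inner one does, a zero is plugged into a multilinear operation.\<close>

lemma operad_ideal_eval_kernel: "free.operad_ideal (eval_kernel :: nat \<Rightarrow> (flex_gen tree \<Rightarrow>\<^sub>0 'k::field) set)"
  unfolding free.operad_ideal_def
proof (intro conjI allI ballI impI)
  fix m n i and f g :: "flex_gen tree \<Rightarrow>\<^sub>0 'k"
  show "lincomb.subspace (eval_kernel n :: (flex_gen tree \<Rightarrow>\<^sub>0 'k) set)"
    by (rule subspace_eval_kernel)
  show "eval_kernel n \<subseteq> (free_component n :: (flex_gen tree \<Rightarrow>\<^sub>0 'k) set)"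
    by (auto simp: eval_kernel_def)
  show "free_comp f i g \<in> eval_kernel (m + n - 1)"
    if f: "f \<in> eval_kernel m" and g: "g \<in> free_component n" and i: "1 \<le> i \<and> i \<le> m"
  proof -
    have f': "f \<in> free_component m" using f by (simp add: eval_kernel_def)
    have "eval (free_comp f i g) e = 0" for e
    proof (induction g rule: lincomb_induct)
      case (single s b)
      show ?case
        using f i by (simp add: eval_free_comp_single_right[OF f'] eval_kernel_def)
    qed (simp_all add: free_comp_add_right)
    then show ?thesis using free_comp_closed[OF f' g] i by (simp add: eval_kernel_def)
  qed
  show "free_comp f i g \<in> eval_kernel (m + n - 1)"
    if f: "f \<in> free_component m" and g: "g \<in> eval_kernel n" and i: "1 \<le> i \<and> i \<le> m"
  proof -
    have g': "g \<in> free_component n" using g by (simp add: eval_kernel_def)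
    have "eval (free_comp f i g) e = 0" for e
      using f
    proof (induction rule: free_induct)
      case (single t a)
      then show ?case
        using g i by (simp add: eval_free_comp_single_left[OF g'] eval_kernel_def eval_tree_plug_zero)
    qed (simp_all add: free_comp_add_left)
    then show ?thesis using free_comp_closed[OF f g'] i by (simp add: eval_kernel_def)
  qed
qed

text \<open>The generated ideal is the least ideal containing the relation, so
  \<open>mult_flexible\<close> suffices.\<close>

lemma flex_ideal_subset_eval_kernel: "flex_ideal n \<subseteq> eval_kernel n"
proof -
  have "flex_relation \<in> eval_kernel 3"
    unfolding eval_kernel_def
    using flex_relation_component
    by (simp add: flex_relation_def left_comb_def right_comb_def mult_flexible numeral_2_eq_2)
  then have "free.operad_ideal eval_kernel \<and>
      (\<forall>m. (if m = 3 then {flex_relation} else {}) \<subseteq> eval_kernel m)"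
    using operad_ideal_eval_kernel by simp
  then show ?thesis
    unfolding flex_ideal_def free.generated_ideal_def by blast
qed

text \<open>Feeding the one-leaf tree into every input computes the reduced form, written in the
  model where \<open>Succ\<close> means \<open>*\<close>.\<close>

definition normal_form :: "(flex_gen tree \<Rightarrow>\<^sub>0 'k::field) \<Rightarrow> flex_gen tree \<Rightarrow>\<^sub>0 'k" where
  "normal_form f = eval f (\<lambda>_. Poly_Mapping.single Leaf 1)"

text \<open>A constant assignment is unaffected by the shift for the right subtree.\<close>

lemma normal_form_node: "normal_form (node g f h) = mult g (normal_form f) (normal_form h)"
proof (induction f rule: lincomb_induct)
  case (single t a)
  show ?case
  proof (induction h rule: lincomb_induct)
    case (single s b)
    show ?case
      by (simp add: normal_form_def node_def bilin_ext_single mult_scale_left mult_scale_right)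
  qed (simp_all add: normal_form_def node_def bilin_ext_add_right mult_add_right)
qed (simp_all add: normal_form_def node_def bilin_ext_add_left mult_add_left)

text \<open>Translates a tree of the model back, reading \<open>Succ\<close> as \<open>*\<close>.\<close>

fun expand :: "flex_gen tree \<Rightarrow> flex_gen tree \<Rightarrow>\<^sub>0 'k::field" where
  "expand Leaf = Poly_Mapping.single Leaf 1"
| "expand (Node l g r) =
     node g (expand l) (expand r) - (if g = Succ then node Prec (expand l) (expand r) else 0)"

lemma normal_form_diff: "normal_form (f - g) = normal_form f - normal_form g"
  by (simp add: normal_form_def)

text \<open>At a \<open>Succ\<close> node of a normal tree the left child is a leaf or has root
  \<open>Succ\<close>, so \<open>star\<close> returns a single tree without rewriting.\<close>

lemma normal_form_expand: "normal t \<Longrightarrow> normal_form (expand t) = Poly_Mapping.single t 1"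
proof (induction t)
  case Leaf
  show ?case by (simp add: normal_form_def)
next
  case (Node l g r)
  then have "normal_form (expand (Node l g r) :: _ \<Rightarrow>\<^sub>0 'a) =
      (if g = Succ then bilin_ext star else node Prec) (Poly_Mapping.single l 1) (Poly_Mapping.single r 1)"
    by (cases g) (simp_all add: normal_form_diff normal_form_node mult_def)
  also have "\<dots> = Poly_Mapping.single (Node l g r) 1"
    using Node.prems by (cases g; cases l) (auto simp: node_def bilin_ext_single)
  finally show ?case .
qed

lemma expand_component: "expand t \<in> free_component (size1 t)"
proof (induction t)
  case Leaf
  show ?case by (simp add: single_free_component)
next
  case (Node l g r)
  have "Poly_Mapping.keys (node h (expand l) (expand r) :: _ \<Rightarrow>\<^sub>0 'a) \<subseteq> {t. size1 t = size1 l + size1 r}" for h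
    unfolding node_def
    by (rule keys_bilin_ext_subset) (use Node in \<open>auto simp: free_component_def\<close>)
  then have "node h (expand l) (expand r) \<in> (free_component (size1 l + size1 r) :: (_ \<Rightarrow>\<^sub>0 'a) set)" for h
    by (auto simp: free_component_def)
  then show ?case
    by (auto intro!: lincomb.subspace_diff[OF subspace_free_component])
qed

lemma keys_normal_form:
  assumes "f \<in> free_component n"
  shows "Poly_Mapping.keys (normal_form f) \<subseteq> normal_trees n"
proof -
  have "Poly_Mapping.keys (eval_tree t (\<lambda>_. Poly_Mapping.single Leaf 1) :: _ \<Rightarrow>\<^sub>0 'a) \<subseteq> normal_trees (size1 t)" for t
  proof (induction t)
    case Leaf
    show ?case by (simp add: normal_trees_def)
  next
    case (Node l g r)
    then show ?case by (simp add: keys_mult)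
  qed
  moreover have "size1 t = n" if "t \<in> Poly_Mapping.keys f" for t
    using assms that by (simp add: free_component_def)
  ultimately show ?thesis
    unfolding normal_form_def eval_def by (metis keys_lin_ext_subset)
qed

section \<open>Normal trees form a basis\<close>

text \<open>Input 2 is filled first, since filling input 1 would renumber it.\<close>

definition flex_node :: "flex_gen \<Rightarrow> 'k::field flex \<Rightarrow> 'k flex \<Rightarrow> 'k flex" where
  "flex_node g a b =
     flex_comp (flex_comp (abs_flex (Poly_Mapping.single (Node Leaf g Leaf) 1)) 2 b) 1 a"

lemma node_eq_free_comp:
  "node g f h = free_comp (free_comp (Poly_Mapping.single (Node Leaf g Leaf) 1) 2 h) 1 f"
proof (induction f rule: lincomb_induct)
  case (single t a)
  show ?case
    by (induction h rule: lincomb_induct)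
       (simp_all add: node_def bilin_ext_single bilin_ext_add_right free_comp_add_left
          free_comp_add_right mult.commute)
qed (simp_all add: node_def bilin_ext_add_left free_comp_add_right)

lemma abs_flex_node: "abs_flex (node g f h) = flex_node g (abs_flex f) (abs_flex h)"
  by (simp add: flex_node_def flex_comp.abs_eq node_eq_free_comp)

lemma flex_abs_cases: obtains f where "a = abs_flex f"
  using flex.abs_induct[of "\<lambda>x. \<exists>f. x = abs_flex f" a] that by blast

lemma flex_node_add_left: "flex_node g (a + a') b = flex_node g a b + flex_node g a' b"
  by (rule flex_abs_cases[of a], rule flex_abs_cases[of a'], rule flex_abs_cases[of b])
     (simp add: plus_flex.abs_eq node_def bilin_ext_add_left flip: abs_flex_node)

lemma flex_node_add_right: "flex_node g a (b + b') = flex_node g a b + flex_node g a b'"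
  by (rule flex_abs_cases[of a], rule flex_abs_cases[of b], rule flex_abs_cases[of b'])
     (simp add: plus_flex.abs_eq node_def bilin_ext_add_right flip: abs_flex_node)

lemma flex_node_scale_left: "flex_node g (flex_scale c a) b = flex_scale c (flex_node g a b)"
  by (rule flex_abs_cases[of a], rule flex_abs_cases[of b])
     (simp add: flex_scale.abs_eq node_def bilin_ext_scale_left flip: abs_flex_node)

lemma flex_node_scale_right: "flex_node g a (flex_scale c b) = flex_scale c (flex_node g a b)"
  by (rule flex_abs_cases[of a], rule flex_abs_cases[of b])
     (simp add: flex_scale.abs_eq node_def bilin_ext_scale_right flip: abs_flex_node)

lemma flex_node_diff_left: "flex_node g (a - a') b = flex_node g a b - flex_node g a' b"
  using flex_node_add_left[of g "a - a'" a' b] by (simp add: algebra_simps)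

lemma flex_node_diff_right: "flex_node g a (b - b') = flex_node g a b - flex_node g a b'"
  using flex_node_add_right[of g a "b - b'" b'] by (simp add: algebra_simps)

text \<open>The instance of the relation at arbitrary arguments, as an operadic composite. Filling
  inputs from right to left keeps the remaining slot numbers valid.\<close>

lemma free_comp_flex_relation:
  "free_comp (free_comp (free_comp flex_relation 3 c) 2 b) 1 a =
     node Succ (node Succ a b) c - node Succ a (node Succ b c)
     - node Prec (node Prec a b) c + node Prec a (node Prec b c)"
proof -
  have comb: "free_comp (free_comp (free_comp (left_comb g h) 3 c) 2 b) 1 a = node h (node g a b) c"
    "free_comp (free_comp (free_comp (right_comb g h) 3 c) 2 b) 1 a = node g a (node h b c)" for g h
  proof (induction a rule: lincomb_induct)
    case (single t p)
    show "free_comp (free_comp (free_comp (left_comb g h) 3 c) 2 b) 1 (Poly_Mapping.single t p) =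
        node h (node g (Poly_Mapping.single t p) b) c"
      "free_comp (free_comp (free_comp (right_comb g h) 3 c) 2 b) 1 (Poly_Mapping.single t p) =
        node g (Poly_Mapping.single t p) (node h b c)"
    proof (induction b rule: lincomb_induct)
      case (single s q)
      show "free_comp (free_comp (free_comp (left_comb g h) 3 c) 2 (Poly_Mapping.single s q)) 1 (Poly_Mapping.single t p) =
          node h (node g (Poly_Mapping.single t p) (Poly_Mapping.single s q)) c"
        "free_comp (free_comp (free_comp (right_comb g h) 3 c) 2 (Poly_Mapping.single s q)) 1 (Poly_Mapping.single t p) =
          node g (Poly_Mapping.single t p) (node h (Poly_Mapping.single s q) c)"
        by (induction c rule: lincomb_induct)
           (simp_all add: left_comb_def right_comb_def node_def bilin_ext_simps
              free_comp_add_left free_comp_add_right mult_ac)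
    qed (simp_all add: node_def bilin_ext_add_left bilin_ext_add_right free_comp_add_left free_comp_add_right)
  qed (simp_all add: node_def bilin_ext_add_left bilin_ext_add_right free_comp_add_left free_comp_add_right)
  have diff: "free_comp (f - f') i g = free_comp f i g - free_comp f' i g"
    for f f' g :: "flex_gen tree \<Rightarrow>\<^sub>0 'a" and i
    using free_comp_add_left[of "f - f'" f' i g] by (simp add: algebra_simps)
  show ?thesis
    by (simp add: flex_relation_def diff free_comp_add_left comb[unfolded One_nat_def])
qed

lemma flex_node_flexible:
  "flex_node Succ (flex_node Succ a b) c - flex_node Succ a (flex_node Succ b c)
     - flex_node Prec (flex_node Prec a b) c + flex_node Prec a (flex_node Prec b c) = 0"
proof -
  obtain f g h where eq: "a = abs_flex f" "b = abs_flex g" "c = abs_flex h"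
    by (metis flex_abs_cases)
  have "free_comp (free_comp (free_comp flex_relation 3 h) 2 g) 1 f \<in> flex_ideal_total"
    by (intro flex_ideal_total_comp_left flex_ideal_le_total[OF flex_relation_ideal])
  then have "abs_flex (free_comp (free_comp (free_comp flex_relation 3 h) 2 g) 1 f) = 0"
    by (simp add: zero_flex_def flex.abs_eq_iff)
  then show ?thesis
    unfolding free_comp_flex_relation eq
    by (simp add: abs_flex_node flip: plus_flex.abs_eq minus_flex.abs_eq)
qed

section \<open>Soundness of the rewriting in the quotient\<close>

definition flex_star :: "'k::field flex \<Rightarrow> 'k flex \<Rightarrow> 'k flex" where
  "flex_star a b = flex_node Succ a b - flex_node Prec a b"

interpretation flex: vector_space flex_scale
  by (rule vector_space_flex_scale)

lemma flex_star_add_left: "flex_star (a + a') b = flex_star a b + flex_star a' b"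
  and flex_star_add_right: "flex_star a (b + b') = flex_star a b + flex_star a b'"
  and flex_star_scale_left: "flex_star (flex_scale c a) b = flex_scale c (flex_star a b)"
  and flex_star_scale_right: "flex_star a (flex_scale c b) = flex_scale c (flex_star a b)"
  by (simp_all add: flex_star_def flex_node_add_left flex_node_add_right flex_node_scale_left
      flex_node_scale_right flex.scale_right_diff_distrib)

text \<open>The rewrite rule is the defining relation of the quotient solved for the product of a
  \<open>Prec\<close> node with \<open>c\<close>.\<close>

lemma flex_star_Prec:
  "flex_star (flex_node Prec a b) c =
      flex_node Prec a (flex_star b c) + flex_star a (flex_node Prec b c) + flex_star a (flex_star b c)
    - flex_node Prec (flex_star a b) c - flex_star (flex_star a b) c"
  using flex_node_flexible[of a b c]
  by (simp add: flex_star_def flex_node_diff_left flex_node_diff_right algebra_simps)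

text \<open>The linear map from the model to the operad that turns out to be inverse to
  \<open>normal_form\<close> on combinations of normal trees.\<close>

definition flex_expand :: "(flex_gen tree \<Rightarrow>\<^sub>0 'k::field) \<Rightarrow> 'k flex" where
  "flex_expand f = abs_flex (lin_ext expand f)"

lemma flex_expand_zero [simp]: "flex_expand 0 = 0"
  and flex_expand_add: "flex_expand (f + g) = flex_expand f + flex_expand g"
  and flex_expand_diff: "flex_expand (f - g) = flex_expand f - flex_expand g"
  and flex_expand_scale: "flex_expand (lincomb_scale c f) = flex_scale c (flex_expand f)"
  and flex_expand_single: "flex_expand (Poly_Mapping.single t c) = flex_scale c (abs_flex (expand t))"
  by (simp_all add: flex_expand_def lin_ext_add lin_ext_diff lin_ext_scale
      zero_flex_def plus_flex.abs_eq minus_flex.abs_eq flex_scale.abs_eq)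

text \<open>Agreement is demanded only on the support of \<open>f\<close>, since the hypothesis of
  \<open>star_induct\<close> covers only trees of bounded count.\<close>

lemma flex_expand_lin_ext:
  assumes "\<And>u. u \<in> Poly_Mapping.keys f \<Longrightarrow> flex_expand (h u) = L (abs_flex (expand u))"
    and add: "\<And>a b. L (a + b) = L a + L b"
    and scale: "\<And>c a. L (flex_scale c a) = flex_scale c (L a)"
  shows "flex_expand (lin_ext h f) = L (flex_expand f)"
proof -
  have "L 0 = 0" using scale[of 0 0] by simp
  then show ?thesis
    by (induction f rule: lincomb_induct)
       (simp_all add: assms lin_ext_add flex_expand_add flex_expand_scale flex_expand_single)
qed

lemma flex_star_expand:
  "flex_star (abs_flex (expand l)) (abs_flex (expand r)) =
     flex_expand (Poly_Mapping.single (Node l Succ r) 1)"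
  and flex_Prec_expand:
  "flex_node Prec (abs_flex (expand l)) (abs_flex (expand r)) =
     flex_expand (Poly_Mapping.single (Node l Prec r) 1)"
  by (simp_all add: flex_expand_single flex_star_def flip: abs_flex_node minus_flex.abs_eq)

text \<open>\<open>star\<close> and \<open>flex_star\<close> obey the same recursion, so the five
  terms are compared one by one; \<open>star_prec_count\<close> admits the hypothesis for the trees
  in \<open>star x y\<close>.\<close>

lemma flex_expand_star:
  "flex_expand (star t s) = flex_star (abs_flex (expand t)) (abs_flex (expand s))"
proof (induction t s rule: star_induct)
  case (Prec x y z)
  let ?X = "abs_flex (expand x) :: 'a flex"
  let ?Y = "abs_flex (expand y) :: 'a flex"
  let ?Z = "abs_flex (expand z) :: 'a flex"
  have xy: "flex_expand (star x y) = flex_star ?X ?Y" and yz: "flex_expand (star y z) = flex_star ?Y ?Z"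
    by (simp_all add: Prec)
  have "flex_expand (lin_ext (\<lambda>u. Poly_Mapping.single (Node x Prec u) 1) (star y z)) =
      flex_node Prec ?X (flex_star ?Y ?Z)"
    unfolding yz[symmetric]
    by (rule flex_expand_lin_ext) (simp_all add: flex_Prec_expand flex_node_add_right flex_node_scale_right)
  moreover have "flex_expand (star x (Node y Prec z)) = flex_star ?X (flex_node Prec ?Y ?Z)"
    by (simp add: Prec abs_flex_node)
  moreover have "flex_expand (lin_ext (star x) (star y z)) = flex_star ?X (flex_star ?Y ?Z)"
    unfolding yz[symmetric]
    by (rule flex_expand_lin_ext) (simp_all add: Prec flex_star_add_right flex_star_scale_right)
  moreover have "flex_expand (lin_ext (\<lambda>u. Poly_Mapping.single (Node u Prec z) 1) (star x y)) =
      flex_node Prec (flex_star ?X ?Y) ?Z"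
    unfolding xy[symmetric]
    by (rule flex_expand_lin_ext[where L = "\<lambda>a. flex_node Prec a ?Z"])
       (simp_all add: flex_Prec_expand flex_node_add_left flex_node_scale_left)
  moreover have "flex_expand (lin_ext (\<lambda>u. star u z) (star x y)) = flex_star (flex_star ?X ?Y) ?Z"
    unfolding xy[symmetric]
    by (rule flex_expand_lin_ext[where L = "\<lambda>a. flex_star a ?Z"])
       (simp_all add: Prec star_prec_count flex_star_add_left flex_star_scale_left)
  ultimately show ?case
    by (simp add: star_Prec flex_expand_add flex_expand_diff abs_flex_node flex_star_Prec)
qed (simp_all only: star_Leaf star_Succ flex_star_expand)

lemma flex_expand_mult: "flex_expand (mult g a b) = flex_node g (flex_expand a) (flex_expand b)"
proof -
  have "flex_expand (bilin_ext star a b) = flex_star (flex_expand a) (flex_expand b)"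
    unfolding bilin_ext_def
    by (rule flex_expand_lin_ext[where L = "\<lambda>a. flex_star a (flex_expand b)"])
       (simp_all add: flex_expand_lin_ext flex_expand_star flex_star_add_left flex_star_add_right
          flex_star_scale_left flex_star_scale_right)
  moreover have "flex_expand (node Prec a b) = flex_node Prec (flex_expand a) (flex_expand b)"
    unfolding node_def bilin_ext_def
    by (rule flex_expand_lin_ext[where L = "\<lambda>a. flex_node Prec a (flex_expand b)"])
       (simp_all add: flex_expand_lin_ext flex_node_add_left flex_node_add_right
          flex_node_scale_left flex_node_scale_right flex_Prec_expand)
  ultimately show ?thesis
    by (cases g) (simp_all add: mult_def flex_expand_add flex_star_def)
qed

text \<open>The spanning half: reduction does not change the class in the quotient, because products
  of the model map to products of the operad.\<close>

lemma flex_expand_normal_form: "flex_expand (normal_form f) = abs_flex f"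
proof (induction f rule: lincomb_induct)
  case zero
  show ?case by (simp add: normal_form_def zero_flex_def)
next
  case (single t c)
  have "flex_expand (normal_form (Poly_Mapping.single t 1)) = abs_flex (Poly_Mapping.single t (1::'a))"
  proof (induction t)
    case Leaf
    show ?case by (simp add: normal_form_def flex_expand_single)
  next
    case (Node l g r)
    have "Poly_Mapping.single (Node l g r) 1 =
        node g (Poly_Mapping.single l (1::'a)) (Poly_Mapping.single r 1)"
      by (simp add: node_def bilin_ext_single)
    then show ?case
      using Node by (simp add: normal_form_node flex_expand_mult abs_flex_node)
  qed
  from arg_cong[OF this, of "flex_scale c"] show ?case
    by (simp add: normal_form_def flex_scale.abs_eq flip: flex_expand_scale)
next
  case (add g h)
  then show ?case by (simp add: normal_form_def flex_expand_add plus_flex.abs_eq)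
qed

lemma lin_ext_expand_component:
  assumes "Poly_Mapping.keys f \<subseteq> normal_trees n"
  shows "lin_ext expand f \<in> free_component n"
proof -
  have "Poly_Mapping.keys (expand t :: _ \<Rightarrow>\<^sub>0 'a) \<subseteq> {u. size1 u = n}" if "t \<in> normal_trees n" for t
  proof -
    have "expand t \<in> (free_component n :: (_ \<Rightarrow>\<^sub>0 'a) set)"
      using that expand_component[of t] by (simp add: normal_trees_def)
    then show ?thesis by (auto simp: free_component_def)
  qed
  then have "Poly_Mapping.keys (lin_ext expand f) \<subseteq> {u. size1 u = n}"
    using assms by (intro keys_lin_ext_subset) blast
  then show ?thesis by (auto simp: free_component_def)
qed

lemma normal_form_lin_ext_expand:
  assumes "Poly_Mapping.keys f \<subseteq> normal_trees n"
  shows "normal_form (lin_ext expand f) = f"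
proof -
  have "normal_form (lin_ext expand f) = lin_ext (\<lambda>t. normal_form (expand t)) f"
    unfolding normal_form_def eval_def by (rule lin_ext_lin_ext)
  also have "\<dots> = lin_ext (\<lambda>t. Poly_Mapping.single t 1) f"
    using assms by (intro lin_ext_cong normal_form_expand) (auto simp: normal_trees_def)
  finally show ?thesis by (simp add: lin_ext_monomials)
qed

text \<open>The independence half: an expansion that is zero in the quotient lies in the ideal,
  evaluation kills it, and its normal form is \<open>f\<close> itself.\<close>

lemma flex_expand_eq_0:
  assumes "Poly_Mapping.keys f \<subseteq> normal_trees n" "flex_expand f = 0"
  shows "f = 0"
proof -
  have "abs_flex (lin_ext expand f) = abs_flex 0"
    using assms(2) by (simp add: flex_expand_def zero_flex_def)
  then have "lin_ext expand f \<in> flex_ideal n"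
    using abs_flex_eq_iff[OF lin_ext_expand_component[OF assms(1)]
        lincomb.subspace_0[OF subspace_free_component]] by simp
  then have "lin_ext expand f \<in> eval_kernel n"
    using flex_ideal_subset_eval_kernel by blast
  then show ?thesis
    using normal_form_lin_ext_expand[OF assms(1)] by (simp add: normal_form_def eval_kernel_def)
qed

section \<open>The dimension as the number of normal trees\<close>

lemma span_monomials:
  "lincomb.span ((\<lambda>t. Poly_Mapping.single t (1::'k::field)) ` A) = {f. Poly_Mapping.keys f \<subseteq> A}"
proof (rule lincomb.span_unique)
  show "(\<lambda>t. Poly_Mapping.single t (1::'k)) ` A \<subseteq> {f. Poly_Mapping.keys f \<subseteq> A}" by auto
  show "lincomb.subspace {f :: _ \<Rightarrow>\<^sub>0 'k. Poly_Mapping.keys f \<subseteq> A}"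
    by (rule lincomb.subspaceI)
       (simp_all add: keys_add_subset subset_trans[OF keys_lincomb_scale])
  fix T assume T: "(\<lambda>t. Poly_Mapping.single t (1::'k)) ` A \<subseteq> T" "lincomb.subspace T"
  show "{f. Poly_Mapping.keys f \<subseteq> A} \<subseteq> T"
  proof
    fix f :: "_ \<Rightarrow>\<^sub>0 'k" assume "f \<in> {f. Poly_Mapping.keys f \<subseteq> A}"
    then have "lin_ext (\<lambda>t. Poly_Mapping.single t 1) f \<in> T"
      unfolding lin_ext_def
      using T by (intro lincomb.subspace_sum lincomb.subspace_scale) auto
    then show "f \<in> T" by (simp only: lin_ext_monomials)
  qed
qed

lemma independent_monomials:
  "lincomb.independent ((\<lambda>t. Poly_Mapping.single t (1::'k::field)) ` A)"
proof
  assume "lincomb.dependent ((\<lambda>t. Poly_Mapping.single t (1::'k)) ` A)"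
  then obtain t where "t \<in> A" and *: "Poly_Mapping.single t (1::'k) \<in>
      lincomb.span ((\<lambda>t. Poly_Mapping.single t (1::'k)) ` A - {Poly_Mapping.single t 1})"
    by (auto simp: lincomb.dependent_def)
  have "(\<lambda>t. Poly_Mapping.single t (1::'k)) ` A - {Poly_Mapping.single t 1} \<subseteq>
      (\<lambda>t. Poly_Mapping.single t 1) ` (A - {t})" by auto
  from subsetD[OF lincomb.span_mono[OF this] *] show False
    by (simp add: span_monomials)
qed

lemma noncom_Flex_eq: "noncom_Flex n = flex_expand ` {f. Poly_Mapping.keys f \<subseteq> normal_trees n}"
proof (intro equalityI subsetI)
  fix a :: "'a flex" assume "a \<in> noncom_Flex n"
  then obtain f where "f \<in> free_component n" "a = abs_flex f" by (auto simp: noncom_Flex_def)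
  then show "a \<in> flex_expand ` {f. Poly_Mapping.keys f \<subseteq> normal_trees n}"
    using keys_normal_form[of f n]
    by (intro image_eqI[of _ _ "normal_form f"]) (simp_all add: flex_expand_normal_form)
qed (auto simp: noncom_Flex_def flex_expand_def lin_ext_expand_component)

lemma dim_noncom_Flex:
  "vector_space.dim flex_scale (noncom_Flex n :: 'k::field flex set) = card (normal_trees n)"
proof -
  interpret L: Vector_Spaces.linear lincomb_scale flex_scale "flex_expand :: _ \<Rightarrow> 'k flex"
    by unfold_locales (simp_all add: flex_expand_add flex_expand_scale)
  let ?M = "(\<lambda>t. Poly_Mapping.single t (1::'k)) ` normal_trees n"
  \<comment> \<open>For a linear map on a subspace, injectivity amounts to a trivial kernel. It
    carries the independent monomials to an independent spanning set.\<close>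
  have inj: "inj_on flex_expand (lincomb.span ?M)"
    by (subst L.inj_on_iff_eq_0[OF lincomb.subspace_span])
       (auto simp: span_monomials intro: flex_expand_eq_0)
  have "noncom_Flex n = flex.span (flex_expand ` ?M)"
    by (simp add: noncom_Flex_eq L.span_image span_monomials)
  then have "flex.dim (noncom_Flex n :: 'k flex set) = card (flex_expand ` ?M)"
    by (simp add: flex.dim_eq_card_independent L.independent_injective_image[OF independent_monomials inj])
  also have "\<dots> = card ?M"
    by (rule card_image[OF inj_on_subset[OF inj lincomb.span_superset]])
  also have "\<dots> = card (normal_trees n)"
    by (intro card_image inj_onI) (metis lookup_single_eq lookup_single_not_eq one_neq_zero)
  finally show ?thesis .
qed

section \<open>Counting normal trees\<close>

lemma finite_trees: "finite {t :: 'g::finite tree. size1 t = n}"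
proof (induction n rule: less_induct)
  case (less n)
  let ?T = "\<Union>i<n. {t :: 'g tree. size1 t = i}"
  have "{t :: 'g tree. size1 t = n} \<subseteq> insert Leaf ((\<lambda>(l, g, r). Node l g r) ` (?T \<times> UNIV \<times> ?T))"
  proof
    fix t :: "'g tree" assume "t \<in> {t. size1 t = n}"
    then show "t \<in> insert Leaf ((\<lambda>(l, g, r). Node l g r) ` (?T \<times> UNIV \<times> ?T))"
      by (cases t) (auto simp: image_iff)
  qed
  moreover have "finite ?T" using less by auto
  then have "finite (insert Leaf ((\<lambda>(l, g, r). Node l g r) ` (?T \<times> (UNIV :: 'g set) \<times> ?T)))"
    by (intro finite.insertI finite_imageI finite_cartesian_product) simp_all
  ultimately show ?case by (rule finite_subset)
qed

instance flex_gen :: finite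
proof
  have "UNIV = {Prec, Succ}" by (auto intro: flex_gen.exhaust)
  then show "finite (UNIV :: flex_gen set)" by (metis finite.emptyI finite.insertI)
qed

text \<open>\<open>A\<close> and \<open>B\<close> are meant to be graded by the number of leaves;
  the union then mirrors the Cauchy product of generating functions.\<close>

definition node_trees :: "'g \<Rightarrow> (nat \<Rightarrow> 'g tree set) \<Rightarrow> (nat \<Rightarrow> 'g tree set) \<Rightarrow> nat \<Rightarrow> 'g tree set" where
  "node_trees g A B n = (\<Union>i\<le>n. (\<lambda>(l, r). Node l g r) ` (A i \<times> B (n - i)))"

lemma card_node_trees:
  fixes A B :: "nat \<Rightarrow> 'g::finite tree set"
  assumes A: "\<And>i. A i \<subseteq> {t. size1 t = i}" and B: "\<And>i. B i \<subseteq> {t. size1 t = i}"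
  shows "card (node_trees g A B n) = (\<Sum>i\<le>n. card (A i) * card (B (n - i)))"
proof -
  have fin: "finite (A i)" "finite (B i)" for i
    by (rule finite_subset[OF A finite_trees], rule finite_subset[OF B finite_trees])
  have "card (node_trees g A B n) = (\<Sum>i\<le>n. card ((\<lambda>(l, r). Node l g r) ` (A i \<times> B (n - i))))"
    unfolding node_trees_def
  proof (rule card_UN_disjoint)
    show "\<forall>i\<in>{..n}. \<forall>j\<in>{..n}. i \<noteq> j \<longrightarrow>
        (\<lambda>(l, r). Node l g r) ` (A i \<times> B (n - i)) \<inter> (\<lambda>(l, r). Node l g r) ` (A j \<times> B (n - j)) = {}"
    proof (intro ballI impI)
      fix i j :: nat assume "i \<noteq> j"
      then have "A i \<inter> A j = {}"
        using subsetD[OF A[of i]] subsetD[OF A[of j]] by auto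
      then show "(\<lambda>(l, r). Node l g r) ` (A i \<times> B (n - i)) \<inter>
          (\<lambda>(l, r). Node l g r) ` (A j \<times> B (n - j)) = {}"
        by auto
    qed
  qed (simp_all add: fin)
  also have "\<dots> = (\<Sum>i\<le>n. card (A i \<times> B (n - i)))"
    by (intro sum.cong refl card_image inj_onI) auto
  finally show ?thesis by (simp add: card_cartesian_product)
qed

lemma mem_node_trees:
  assumes A: "\<And>i. A i \<subseteq> {t. size1 t = i}" and B: "\<And>i. B i \<subseteq> {t. size1 t = i}"
  shows "t \<in> node_trees g A B n \<longleftrightarrow>
    (\<exists>l r. t = Node l g r \<and> size1 t = n \<and> l \<in> A (size1 l) \<and> r \<in> B (size1 r))"
proof
  assume "t \<in> node_trees g A B n"
  then obtain i l r where *: "i \<le> n" "t = Node l g r" "l \<in> A i" "r \<in> B (n - i)"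
    by (auto simp: node_trees_def)
  then have "size1 l = i" "size1 r = n - i"
    using subsetD[OF A *(3)] subsetD[OF B *(4)] by simp_all
  with * show "\<exists>l r. t = Node l g r \<and> size1 t = n \<and> l \<in> A (size1 l) \<and> r \<in> B (size1 r)" by auto
next
  assume "\<exists>l r. t = Node l g r \<and> size1 t = n \<and> l \<in> A (size1 l) \<and> r \<in> B (size1 r)"
  then obtain l r where *: "t = Node l g r" "size1 l + size1 r = n" "l \<in> A (size1 l)" "r \<in> B (size1 r)"
    by auto
  then show "t \<in> node_trees g A B n"
    unfolding node_trees_def
    by (intro UN_I[of "size1 l"] image_eqI[of _ _ "(l, r)"]) auto
qed

definition normal_fps :: "real fps" where
  "normal_fps = Abs_fps (\<lambda>n. real (card (normal_trees n)))"

text \<open>A \<open>Prec\<close> root takes any two normal children, giving \<open>F^2\<close>;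
  under a \<open>Succ\<close> root the left child must not have root \<open>Prec\<close>, giving
  \<open>(F - F^2) F\<close>.\<close>

lemma normal_fps_equation:
  "normal_fps = fps_X + 2 * normal_fps ^ 2 - normal_fps ^ 3"
proof -
  let ?N = normal_trees
  \<comment> \<open>\<open>P\<close> and \<open>S\<close> are the normal trees with root
    \<open>Prec\<close> and \<open>Succ\<close>; \<open>S\<close> is described by removing
    \<open>P\<close> from the left children.\<close>
  define P where "P = node_trees Prec ?N ?N"
  define S where "S = node_trees Succ (\<lambda>i. ?N i - P i) ?N"
  have N: "?N i \<subseteq> {t. size1 t = i}" for i by (auto simp: normal_trees_def)
  have NP: "?N i - P i \<subseteq> {t. size1 t = i}" for i by (rule subset_trans[OF Diff_subset N])
  have finN: "finite (?N i)" for i by (rule finite_subset[OF N finite_trees])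
  have P_iff: "t \<in> P n \<longleftrightarrow> size1 t = n \<and> (\<exists>l r. t = Node l Prec r \<and> normal l \<and> normal r)" for t n
    unfolding P_def mem_node_trees[OF N N] by (auto simp: normal_trees_def)
  have PN: "P n \<subseteq> ?N n" for n by (auto simp: P_iff normal_trees_def)
  have normal_Succ: "normal (Node l Succ r) \<longleftrightarrow> normal l \<and> normal r \<and> l \<notin> P (size1 l)" for l r
  proof (cases l)
    case (Node x h y)
    then show ?thesis by (cases h) (auto simp: P_iff)
  qed (simp add: P_iff)
  have S_iff: "t \<in> S n \<longleftrightarrow> size1 t = n \<and>
      (\<exists>l r. t = Node l Succ r \<and> normal t)" for t n
    unfolding S_def mem_node_trees[OF NP N]
    by (auto simp: normal_trees_def normal_Succ simp del: normal.simps)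
  have N_eq: "?N n = (if n = 1 then {Leaf} else {}) \<union> (P n \<union> S n)" for n
  proof (intro set_eqI)
    fix t
    show "t \<in> ?N n \<longleftrightarrow> t \<in> (if n = 1 then {Leaf} else {}) \<union> (P n \<union> S n)"
    proof (cases t)
      case (Node l g r)
      then show ?thesis by (cases g) (auto simp: normal_trees_def P_iff S_iff)
    qed (auto simp: normal_trees_def P_iff S_iff)
  qed
  have SN: "S n \<subseteq> ?N n" for n by (auto simp: S_iff normal_trees_def)
  have fin: "finite (P n)" "finite (S n)" for n
    by (rule finite_subset[OF PN finN], rule finite_subset[OF SN finN])
  have "card (?N n) = card (if n = 1 then {Leaf :: flex_gen tree} else {}) + card (P n \<union> S n)" for n
    by (subst N_eq, rule card_Un_disjoint) (auto simp: fin P_iff S_iff)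
  moreover have "card (P n \<union> S n) = card (P n) + card (S n)" for n
    by (rule card_Un_disjoint) (auto simp: fin P_iff S_iff)
  ultimately have card_N: "card (?N n) = (if n = 1 then 1 else 0) + card (P n) + card (S n)" for n
    by simp
  define p s where "p = Abs_fps (\<lambda>n. real (card (P n)))" and "s = Abs_fps (\<lambda>n. real (card (S n)))"
  have "normal_fps = fps_X + p + s"
    by (rule fps_ext) (simp add: normal_fps_def p_def s_def card_N)
  moreover have "p = normal_fps * normal_fps"
    by (rule fps_ext)
       (simp add: normal_fps_def p_def P_def card_node_trees[OF N N] fps_mult_nth atLeast0AtMost)
  \<comment> \<open>Since \<open>P i\<close> is contained in \<open>?N i\<close>, the set difference
    becomes a difference of coefficients.\<close>
  moreover have "s = (normal_fps - p) * normal_fps"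
    by (rule fps_ext)
       (simp add: normal_fps_def p_def s_def S_def card_node_trees[OF NP N] fps_mult_nth atLeast0AtMost
          card_Diff_subset[OF fin(1) PN] of_nat_diff[OF card_mono[OF finN PN]])
  ultimately show ?thesis
    by (simp add: algebra_simps power2_eq_square power3_eq_cube)
qed

section \<open>Coefficients of the powers of the generating function\<close>

lemma Suc_times_choose_Suc: "Suc k * (n choose Suc k) = (n - k) * (n choose k)"
proof (cases n)
  case (Suc m)
  then show ?thesis
    using Suc_times_binomial[of k m] binomial_absorb_comp[of n k] by (simp only: diff_Suc_1)
qed simp

text \<open>Multiplying the equation by \<open>F^r\<close> gives
  \<open>F^(r+1) = X F^r + 2 F^(r+2) - F^(r+3)\<close>. With \<open>m\<close> the degree minus the
  exponent, the right-hand terms have \<open>m\<close> (with smaller exponent), \<open>m - 1\<close>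
  and \<open>m - 2\<close>; hence an outer induction on \<open>m\<close> and an inner one on
  \<open>r\<close>. The case \<open>r = m = 0\<close> is excluded, as the quotient would be
  \<open>0 / 0 = 0\<close> while \<open>F^0\<close> has constant term 1.\<close>

lemma fps_cubic_power_nth:
  fixes F :: "'a::field_char_0 fps"
  assumes F: "F = fps_X + 2 * F ^ 2 - F ^ 3" and F0: "fps_nth F 0 = 0" and "r + m \<ge> 1"
  shows "fps_nth (F ^ r) (r + m) =
    of_nat r / of_nat (r + m) * of_nat ((2 * r + 3 * m - 1) choose m)"
  using assms(3)
proof (induction m arbitrary: r rule: less_induct)
  case (less m)
  have step: "fps_nth (F ^ Suc r) (Suc r + m) = fps_nth (F ^ r) (r + m)
      + 2 * fps_nth (F ^ (r + 2)) (Suc r + m) - fps_nth (F ^ (r + 3)) (Suc r + m)" for r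
  proof -
    have "F ^ Suc r = F * F ^ r" by simp
    \<comment> \<open>The equation has \<open>F\<close> on both sides and would loop as a rewrite
      rule, so it is applied to the one factor \<open>F\<close> only.\<close>
    also have "\<dots> = (fps_X + 2 * F ^ 2 - F ^ 3) * F ^ r"
      by (rule arg_cong[OF F, of "\<lambda>G. G * F ^ r"])
    also have "\<dots> = fps_X * F ^ r + fps_const 2 * F ^ (r + 2) - F ^ (r + 3)"
      by (simp add: algebra_simps power_add numeral_fps_const power2_eq_square power3_eq_cube)
    finally have "F ^ Suc r = fps_X * F ^ r + fps_const 2 * F ^ (r + 2) - F ^ (r + 3)" .
    then show ?thesis by (simp only: fps_add_nth fps_sub_nth fps_mult_left_const_nth) simp
  qed
  have below: "fps_nth (F ^ k) n = 0" if "n < k" for k n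
    using F0 that by (simp add: startsby_zero_power_prefix)
  from less.prems show ?case
  proof (induction r)
    case 0
    then show ?case by simp
  next
    case (Suc r)
    \<comment> \<open>For \<open>m < 2\<close> one or both of the last terms fall below the lowest
      degree of their power and vanish by \<open>below\<close>.\<close>
    consider "m = 0" | "m = 1" | k where "m = Suc (Suc k)"
      by (metis One_nat_def not0_implies_Suc)
    then show ?case
    proof cases
      case 1
      have "fps_nth (F ^ r) r = 1"
        \<comment> \<open>The inner hypothesis excludes \<open>r = 0\<close> here; there
          \<open>F^0 = 1\<close> is used directly.\<close>
        using 1 Suc.IH by (cases "r = 0") simp_all
      then have "fps_nth (F ^ Suc r) (Suc r + m) = 1"
        unfolding step using 1 below[of "Suc r" "r + 2"] below[of "Suc r" "r + 3"] by simp
      then show ?thesis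
        using 1 by (simp only: add_0_right) (simp del: of_nat_Suc)
    next
      case 2
      have "fps_nth (F ^ (r + 2)) (r + 2) = 1"
        using less.IH[of 0 "r + 2"] 2 of_nat_neq_0[of "Suc r", where 'a = 'a] by simp
      moreover have "fps_nth (F ^ r) (r + 1) = of_nat r * 2"
      proof -
        \<comment> \<open>The factor \<open>Suc r\<close> is kept visible to cancel against the
          denominator.\<close>
        have "(2 * r + 3 * 1 - 1) choose 1 = Suc r * 2" by simp
        then have "fps_nth (F ^ r) (r + 1) = of_nat r / of_nat (Suc r) * (of_nat (Suc r * 2) :: 'a)"
          using Suc.IH 2 by simp
        then show ?thesis by (simp only: of_nat_mult) (simp del: of_nat_Suc)
      qed
      ultimately have "fps_nth (F ^ Suc r) (Suc r + m) = of_nat (Suc r) * 2"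
        unfolding step using 2 below[of "r + 2" "r + 3"] by simp
      then show ?thesis
      proof -
        assume eq: "fps_nth (F ^ Suc r) (Suc r + m) = of_nat (Suc r) * 2"
        have "(2 * Suc r + 3 * m - 1) choose m = Suc (Suc r) * 2" "Suc r + m = Suc (Suc r)"
          using 2 by simp_all
        then show ?thesis unfolding eq by (simp only: of_nat_mult) (simp del: of_nat_Suc)
      qed
    next
      case (3 k)
      \<comment> \<open>Chosen so that \<open>N + k = 2 * r + 3 * m - 1\<close>; the upper indices
        of all four binomials are then \<open>N + k\<close> plus 0, 1 or 2.\<close>
      define N where "N = 2 * r + 2 * k + 5"
      define c where "c = (of_nat ((N + k) choose k) :: 'a)"
      have nz: "(1 + of_nat k :: 'a) \<noteq> 0" "(2 + of_nat k :: 'a) \<noteq> 0" "(2 + of_nat r + of_nat k :: 'a) \<noteq> 0"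
          "(3 + of_nat r + of_nat k :: 'a) \<noteq> 0"
        using of_nat_neq_0[of k, where 'a = 'a] of_nat_neq_0[of "Suc k", where 'a = 'a]
          of_nat_neq_0[of "Suc (r + k)", where 'a = 'a] of_nat_neq_0[of "Suc (Suc (r + k))", where 'a = 'a]
        by (simp_all add: algebra_simps)
      have ratio: "(of_nat x :: 'a) = of_nat b * of_nat y / of_nat (Suc a)"
        if "Suc a * x = b * y" for a b x y
      proof -
        have "(of_nat x :: 'a) * of_nat (Suc a) = of_nat b * of_nat y"
          using that by (metis mult.commute of_nat_mult)
        then show ?thesis by (metis nonzero_eq_divide_eq of_nat_neq_0)
      qed
      \<comment> \<open>Together these four ratios express every binomial in the recurrence as a
        rational multiple of \<open>c\<close>.\<close>
      note c1 = ratio[OF Suc_times_binomial[of k "N + k"], folded c_def]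
      note c2 = ratio[OF Suc_times_binomial[of "Suc k" "Suc (N + k)"]]
      note c3 = ratio[OF Suc_times_choose_Suc[of k "N + k"], folded c_def]
      note c4 = ratio[OF Suc_times_choose_Suc[of "Suc k" "N + k"]]
      have idx: "r + m = Suc (Suc (r + k))" "Suc r + m = Suc (Suc (Suc (r + k)))"
          "r + 2 + Suc k = Suc (Suc (Suc (r + k)))" "r + 3 + k = Suc (Suc (Suc (r + k)))"
          "2 * r + 3 * m - 1 = N + k" "2 * (r + 2) + 3 * Suc k - 1 = Suc (N + k)"
          "2 * (r + 3) + 3 * k - 1 = N + k" "2 * Suc r + 3 * m - 1 = Suc (Suc (N + k))"
        using 3 by (simp_all add: N_def)
      have e1: "fps_nth (F ^ r) (r + m) =
          of_nat r / of_nat (Suc (Suc (r + k))) * of_nat (N + k choose Suc (Suc k))"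
        using Suc.IH unfolding idx using 3 by simp
      have e2: "fps_nth (F ^ (r + 2)) (Suc r + m) =
          of_nat (r + 2) / of_nat (Suc (Suc (Suc (r + k)))) * of_nat (Suc (N + k) choose Suc k)"
        using less.IH[of "Suc k" "r + 2"] unfolding idx using 3 by simp
      have e3: "fps_nth (F ^ (r + 3)) (Suc r + m) =
          of_nat (r + 3) / of_nat (Suc (Suc (Suc (r + k)))) * c"
        using less.IH[of k "r + 3"] unfolding idx c_def using 3 by simp
      have "of_nat (Suc r) / of_nat (Suc r + m) * of_nat ((2 * Suc r + 3 * m - 1) choose m) =
          of_nat (Suc r) / of_nat (Suc (Suc (Suc (r + k))))
            * (of_nat (Suc (Suc (N + k)) choose Suc (Suc k)) :: 'a)"
        unfolding idx unfolding 3 ..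
      also have "\<dots> = fps_nth (F ^ Suc r) (Suc r + m)"
        \<comment> \<open>What remains is an identity of rational functions in \<open>r\<close> and
          \<open>k\<close>, multiplied by \<open>c\<close>.\<close>
        unfolding step e1 e2 e3 c2 c1 c4 c3
        using nz by (simp add: divide_simps N_def of_nat_diff) (simp add: algebra_simps)
      finally show ?thesis by simp
    qed
  qed
qed

theorem theorem5p2:
  fixes n :: nat
  assumes "n \<ge> 1"
  shows "real (vector_space.dim flex_scale (noncom_Flex n :: 'k::field flex set))
           = 1 / real n * real ((3 * n - 2) choose (n - 1))
       \<and> 1 / real n * real ((3 * n - 2) choose (n - 1))
           = fact (3 * n - 2) / (fact n * fact (2 * n - 1))"
proof
  have idx: "2 * 1 + 3 * (n - 1) - 1 = 3 * n - 2" "1 + (n - 1) = n"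
    using assms by simp_all
  \<comment> \<open>Every tree has at least one leaf.\<close>
  have "fps_nth normal_fps 0 = 0"
    by (simp add: normal_fps_def normal_trees_def size1_size)
  from fps_cubic_power_nth[OF normal_fps_equation this, of 1 "n - 1"]
  have "fps_nth normal_fps n = 1 / real n * real ((3 * n - 2) choose (n - 1))"
    unfolding idx using assms by simp
  then show "real (vector_space.dim flex_scale (noncom_Flex n :: 'k flex set)) =
      1 / real n * real ((3 * n - 2) choose (n - 1))"
    by (simp add: dim_noncom_Flex normal_fps_def)
  obtain k where k: "n = Suc k" using assms by (cases n) auto
  show "1 / real n * real ((3 * n - 2) choose (n - 1)) = fact (3 * n - 2) / (fact n * fact (2 * n - 1))"
    \<comment> \<open>With \<open>n = k + 1\<close> the lower factorials are \<open>fact k\<close>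
      and \<open>fact (2 * k + 1)\<close>, and \<open>n * fact k = fact n\<close>.\<close>
    using binomial_fact[of k "3 * k + 1", where 'a = real] by (simp add: k field_simps)
qed

end
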